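(* Let $G$ be a finite nilpotent group. Then $\Gamma_S(G)$ is triangle-free if and only if $G$ is either a cyclic $p$-group (for some prime $p$), or a generalized quaternion group $Q_{2^n}$, or $Q_{2^a}\times C_{q^b}$ (where $a\ge 3$, $b\ge 1$ and $q$ is an odd prime), or a cyclic group $C_{p^kq^s}$, where $p,q$ are distinct primes and $k,s\ge 1$.
   Context: For a group $G$ with identity $e$, the intersection subgroup graph $\Gamma_S(G)$ is the simple graph whose vertices are the non-trivial subgroups $H$ of $G$ such that $H\cap K=\{e\}$ for some non-trivial subgroup $K$ of $G$; two distinct vertices $H,K$ are adjacent if and only if $H\cap K=\{e\}$. (The vertex set may be empty; the null graph is regarded as triangle-free.) A graph is triangle-free if it contains no triangle. $C_n$ is the cyclic group of order $n$ and $Q_{2^a}$ ($a\ge 3$) is the generalized quaternion group of order $2^a$. *)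

theory Defs
  imports
    "HOL-Algebra.Algebra"
    "HOL-Computational_Algebra.Primes"
    "Graph_Theory.Graph_Theory"
begin

section \<open>Nilpotent groups\<close>

text \<open>The commutator is written as in \<^const>\<open>derived\<close>, that is \<open>[x, y] = x y x\<^sup>-\<^sup>1 y\<^sup>-\<^sup>1\<close>; the series
  starts with \<open>G\<close> at index \<open>0\<close>.\<close>

primrec lower_central_series :: "('a, 'b) monoid_scheme \<Rightarrow> nat \<Rightarrow> 'a set" where
  "lower_central_series G 0 = carrier G"
| "lower_central_series G (Suc n) =
     generate G (\<Union>x \<in> lower_central_series G n. \<Union>y \<in> carrier G.
       {x \<otimes>\<^bsub>G\<^esub> y \<otimes>\<^bsub>G\<^esub> inv\<^bsub>G\<^esub> x \<otimes>\<^bsub>G\<^esub> inv\<^bsub>G\<^esub> y})"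

definition nilpotent :: "('a, 'b) monoid_scheme \<Rightarrow> bool" where
  "nilpotent G \<longleftrightarrow> (\<exists>n. lower_central_series G n = {\<one>\<^bsub>G\<^esub>})"


section \<open>Generalized quaternion groups\<close>

text \<open>\<open>generalized_quaternion n\<close> is the group \<open>Q\<close> of order \<open>2\<^sup>n\<close> (meant for \<open>n \<ge> 3\<close>) presented by
  \<open>\<langle>x, y | x\<^sup>N = 1, y\<^sup>2 = x\<^sup>M, y x y\<^sup>-\<^sup>1 = x\<^sup>-\<^sup>1\<rangle>\<close> with \<open>N = 2\<^sup>n\<^sup>-\<^sup>1\<close> and \<open>M = 2\<^sup>n\<^sup>-\<^sup>2\<close>.
  The pair \<open>(i, s)\<close> stands for the normal form \<open>x\<^sup>i\<close> if \<open>s\<close> is \<^const>\<open>False\<close>, and \<open>x\<^sup>i y\<close> if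
  \<open>s\<close> is \<^const>\<open>True\<close>. Moving \<open>y\<close> past \<open>x\<^sup>j\<close> inverts the latter, and a product of two \<open>y\<close>
  contributes \<open>x\<^sup>M\<close>.\<close>

definition generalized_quaternion :: "nat \<Rightarrow> (int \<times> bool) monoid" where
  "generalized_quaternion n =
     \<lparr>carrier = {0..<2 ^ (n - 1)} \<times> UNIV,
      monoid.mult = (\<lambda>(i, s) (j, t).
        ((i + (if s then - j else j) + (if s \<and> t then 2 ^ (n - 2) else 0)) mod 2 ^ (n - 1), s \<noteq> t)),
      one = (0, False)\<rparr>"

lemma group_generalized_quaternion:
  assumes "n \<ge> 2"
  shows "group (generalized_quaternion n)"
proof -
  define M :: int where "M = 2 ^ (n - 2)"
  have "n - 1 = Suc (n - 2)" using assms by simp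
  then have N: "(2::int) ^ (n - 1) = 2 * M" unfolding M_def by (simp only: power_Suc)
  have pos: "M > 0" by (simp add: M_def)
  define Q where "Q = generalized_quaternion n"
  have carr: "carrier Q = {0..<2 * M} \<times> UNIV" and one: "\<one>\<^bsub>Q\<^esub> = (0, False)"
    and mult: "\<And>i s j t. (i, s) \<otimes>\<^bsub>Q\<^esub> (j, t) =
        ((i + (if s then - j else j) + (if s \<and> t then M else 0)) mod (2 * M), s \<noteq> t)"
    unfolding Q_def generalized_quaternion_def N M_def[symmetric] by simp_all
  have assoc: "(a \<otimes>\<^bsub>Q\<^esub> b) \<otimes>\<^bsub>Q\<^esub> c = a \<otimes>\<^bsub>Q\<^esub> (b \<otimes>\<^bsub>Q\<^esub> c)" for a b c
  proof -
    obtain i s j t k u where abc: "a = (i, s)" "b = (j, t)" "c = (k, u)"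
      by (metis surj_pair)
    have *: "(x mod (2 * M) + y) mod (2 * M) = (x' + z * (y' mod (2 * M)) + w) mod (2 * M)"
      if "x + y = x' + z * y' + w + 2 * M * e" for x y x' z y' w e
    proof -
      have "(x mod (2 * M) + y) mod (2 * M) = (x + y) mod (2 * M)" by (rule mod_add_left_eq)
      also have "\<dots> = (x' + z * y' + w) mod (2 * M)" unfolding that by (rule mod_mult_self2)
      also have "\<dots> = (x' + z * (y' mod (2 * M)) + w) mod (2 * M)"
        by (intro mod_add_cong mod_mult_right_eq[symmetric] refl)
      finally show ?thesis .
    qed
    define sg where "sg = (\<lambda>s. if s then - 1 else 1 :: int)"
    define w where "w = (\<lambda>s t. if s \<and> t then M else 0)"
    have mult': "(i, s) \<otimes>\<^bsub>Q\<^esub> (j, t) = ((i + sg s * j + w s t) mod (2 * M), s \<noteq> t)" for i s j t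
      by (simp add: mult sg_def w_def)
    have "\<exists>e. (i + sg s * j + w s t) + (sg (s \<noteq> t) * k + w (s \<noteq> t) u)
      = i + sg s * (j + sg t * k + w t u) + w s (t \<noteq> u) + 2 * M * e"
      by (cases s; cases t; cases u) (auto simp: sg_def w_def intro: exI[of _ 0] exI[of _ 1])
    then obtain e where "(i + sg s * j + w s t) + (sg (s \<noteq> t) * k + w (s \<noteq> t) u)
      = i + sg s * (j + sg t * k + w t u) + w s (t \<noteq> u) + 2 * M * e" by blast
    from *[OF this] show ?thesis
      by (auto simp: abc mult' add.assoc)
  qed
  have "group Q"
  proof (rule groupI)
    fix a assume "a \<in> carrier Q"
    then obtain i s where a: "a = (i, s)" and i: "0 \<le> i" "i < 2 * M" by (auto simp: carr)
    show "\<exists>b\<in>carrier Q. b \<otimes>\<^bsub>Q\<^esub> a = \<one>\<^bsub>Q\<^esub>"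
    proof (cases s)
      case True
      have "((i + M) mod (2 * M) + (M - i)) mod (2 * M) = (i + M + (M - i)) mod (2 * M)"
        by (rule mod_add_left_eq)
      then have "((i + M) mod (2 * M), True) \<otimes>\<^bsub>Q\<^esub> a = \<one>\<^bsub>Q\<^esub>"
        using True by (simp add: a mult one algebra_simps)
      moreover have "((i + M) mod (2 * M), True) \<in> carrier Q" using pos by (simp add: carr)
      ultimately show ?thesis by blast
    next
      case False
      then have "((- i) mod (2 * M), False) \<otimes>\<^bsub>Q\<^esub> a = \<one>\<^bsub>Q\<^esub>"
        by (simp add: a mult one mod_simps)
      moreover have "((- i) mod (2 * M), False) \<in> carrier Q" using pos by (simp add: carr)
      ultimately show ?thesis by blast
    qed
  next
    show "(a \<otimes>\<^bsub>Q\<^esub> b) \<otimes>\<^bsub>Q\<^esub> c = a \<otimes>\<^bsub>Q\<^esub> (b \<otimes>\<^bsub>Q\<^esub> c)" for a b c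
      by (rule assoc)
  qed (use pos in \<open>auto simp: carr one mult\<close>)
  then show ?thesis by (simp add: Q_def)
qed

lemma order_generalized_quaternion:
  assumes "n \<ge> 1"
  shows "order (generalized_quaternion n) = 2 ^ n"
  using assms
  by (cases n) (simp_all add: order_def generalized_quaternion_def card_cartesian_product nat_power_eq)

lemma generalized_quaternion_relations:
  fixes n :: nat
  defines "Q \<equiv> generalized_quaternion n"
  defines "x \<equiv> (1, False)" and "y \<equiv> (0, True)"
  assumes "n \<ge> 2"
  shows "carrier Q = {x [^]\<^bsub>Q\<^esub> i | i::nat. True} \<union> {x [^]\<^bsub>Q\<^esub> i \<otimes>\<^bsub>Q\<^esub> y | i::nat. True}"
    and "x [^]\<^bsub>Q\<^esub> (2 ^ (n - 1) :: nat) = \<one>\<^bsub>Q\<^esub>"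
    and "y \<otimes>\<^bsub>Q\<^esub> y = x [^]\<^bsub>Q\<^esub> (2 ^ (n - 2) :: nat)"
    and "y \<otimes>\<^bsub>Q\<^esub> x \<otimes>\<^bsub>Q\<^esub> inv\<^bsub>Q\<^esub> y = inv\<^bsub>Q\<^esub> x"
proof -
  interpret group Q unfolding Q_def by (rule group_generalized_quaternion) fact
  have gt1: "(1::int) < 2 ^ (n - 1)" using assms(4) by simp
  have carr: "carrier Q = {0..<2 ^ (n - 1)} \<times> UNIV"
    by (simp add: Q_def generalized_quaternion_def)
  have xy: "x \<in> carrier Q" "y \<in> carrier Q" using gt1 by (simp_all add: carr x_def y_def)
  have pow: "x [^]\<^bsub>Q\<^esub> i = (int i mod 2 ^ (n - 1), False)" for i :: nat
  proof (induction i)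
    case 0
    then show ?case by (simp add: Q_def generalized_quaternion_def)
  next
    case (Suc i)
    then show ?case
      by (simp add: Q_def generalized_quaternion_def x_def mod_simps add.commute)
  qed
  have powy: "x [^]\<^bsub>Q\<^esub> i \<otimes>\<^bsub>Q\<^esub> y = (int i mod 2 ^ (n - 1), True)" for i :: nat
    unfolding pow by (simp add: Q_def generalized_quaternion_def y_def)
  show "carrier Q = {x [^]\<^bsub>Q\<^esub> i | i::nat. True} \<union> {x [^]\<^bsub>Q\<^esub> i \<otimes>\<^bsub>Q\<^esub> y | i::nat. True}" (is "_ = ?R")
  proof
    show "carrier Q \<subseteq> ?R"
    proof
      fix a assume "a \<in> carrier Q"
      then obtain j s where a: "a = (j, s)" "0 \<le> j" "j < 2 ^ (n - 1)" by (auto simp: carr)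
      then have "a = (if s then x [^]\<^bsub>Q\<^esub> nat j \<otimes>\<^bsub>Q\<^esub> y else x [^]\<^bsub>Q\<^esub> nat j)"
        using powy[of "nat j"] pow[of "nat j"] by (cases s) auto
      then show "a \<in> ?R" by (auto split: if_splits)
    qed
    show "?R \<subseteq> carrier Q" using xy by auto
  qed
  show "x [^]\<^bsub>Q\<^esub> (2 ^ (n - 1) :: nat) = \<one>\<^bsub>Q\<^esub>"
    unfolding pow by (simp add: Q_def generalized_quaternion_def)
  show "y \<otimes>\<^bsub>Q\<^esub> y = x [^]\<^bsub>Q\<^esub> (2 ^ (n - 2) :: nat)"
    unfolding pow by (simp add: Q_def generalized_quaternion_def y_def)
  have "x \<otimes>\<^bsub>Q\<^esub> (y \<otimes>\<^bsub>Q\<^esub> x) = y"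
    using gt1 by (simp add: Q_def generalized_quaternion_def x_def y_def mod_simps)
  then have "y \<otimes>\<^bsub>Q\<^esub> x = inv\<^bsub>Q\<^esub> x \<otimes>\<^bsub>Q\<^esub> y"
    using xy by (metis inv_solve_left m_closed)
  then show "y \<otimes>\<^bsub>Q\<^esub> x \<otimes>\<^bsub>Q\<^esub> inv\<^bsub>Q\<^esub> y = inv\<^bsub>Q\<^esub> x"
    using xy by (simp add: m_assoc)
qed


section \<open>The intersection subgroup graph\<close>

definition intersection_subgroup_graph :: "('a, 'b) monoid_scheme \<Rightarrow> 'a set pair_pre_digraph" where
  "intersection_subgroup_graph G =
     (let V = {H. subgroup H G \<and> H \<noteq> {\<one>\<^bsub>G\<^esub>} \<and>
                  (\<exists>K. subgroup K G \<and> K \<noteq> {\<one>\<^bsub>G\<^esub>} \<and> H \<inter> K = {\<one>\<^bsub>G\<^esub>})}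
      in \<lparr>pverts = V, parcs = {(H, K) \<in> V \<times> V. H \<noteq> K \<and> H \<inter> K = {\<one>\<^bsub>G\<^esub>}}\<rparr>)"

lemma (in group) graph_intersection_subgroup_graph:
  assumes "finite (carrier G)"
  shows "pair_graph (intersection_subgroup_graph G)"
proof -
  let ?\<Gamma> = "intersection_subgroup_graph G"
  have "pverts ?\<Gamma> \<subseteq> Pow (carrier G)"
    by (auto simp: intersection_subgroup_graph_def Let_def dest: subgroup.mem_carrier)
  then have fin: "finite (pverts ?\<Gamma>)"
    using assms by (meson finite_Pow_iff finite_subset)
  have "parcs ?\<Gamma> \<subseteq> pverts ?\<Gamma> \<times> pverts ?\<Gamma>"
    by (auto simp: intersection_subgroup_graph_def Let_def)
  then have "finite (parcs ?\<Gamma>)"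
    using fin by (meson finite_SigmaI finite_subset)
  with fin show ?thesis
  proof unfold_locales
    have "(K, H) \<in> parcs ?\<Gamma>" if "(H, K) \<in> parcs ?\<Gamma>" for H K
      using that by (simp add: intersection_subgroup_graph_def Let_def Int_commute) blast
    then show "symmetric (with_proj ?\<Gamma>)"
      by (simp add: symmetric_def sym_def)
  qed (simp_all add: intersection_subgroup_graph_def Let_def split: prod.splits)
qed

definition triangle_free :: "('a, 'b) pre_digraph \<Rightarrow> bool" where
  "triangle_free \<Gamma> \<longleftrightarrow> \<not> (\<exists>T. subgraph T \<Gamma> \<and> K\<^bsub>3\<^esub> T)"

end

theory Submission
  imports Defs "HOL-Number_Theory.Residues"
begin

text \<open>Every non-trivial subgroup contains one of prime order, so the graph is triangle-free iff there
  are at most two subgroups of prime order. Two distinct subgroups of the same prime order always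
  yield a third one, either a conjugate of one of them or, if they commute elementwise, a diagonal
  subgroup of their product. Hence the condition says that at most two primes divide the order of
  \<open>G\<close> and that each of them belongs to just one subgroup of prime order.

  A nilpotent group is the product of its \<open>p\<close>-parts, which leaves the classical fact that a finite
  \<open>p\<close>-group with a single subgroup of order \<open>p\<close> is cyclic or generalized quaternion. For this let
  \<open>a\<close> have maximal order. An element \<open>w\<close> outside \<open>\<langle>a\<rangle>\<close> that normalizes \<open>\<langle>a\<rangle>\<close> and has its \<open>p\<close>-th power
  in \<open>\<langle>a\<rangle>\<close> cannot be corrected by a power of \<open>a\<close> to an element of order \<open>p\<close>; computing
  \<open>(w a\<^sup>i)\<^sup>p\<close> this forces \<open>p = 2\<close>, \<open>w\<^sup>-\<^sup>1 a w = a\<^sup>-\<^sup>1\<close> and \<open>w\<^sup>2\<close> to be the involution of \<open>\<langle>a\<rangle>\<close>. So \<open>\<langle>a\<rangle>\<close> has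
  index at most 2 in its normalizer, and since normalizers grow in a nilpotent group, the normalizer
  turns out to be everything.\<close>

section \<open>Cyclic extensions by an element of prime index\<close>

text \<open>An elementwise form, for prime \<open>p\<close>, of having at most one subgroup of order
  \<open>p\<close>. It holds vacuously if \<open>p\<close> is the order of no element, and it passes
  easily to subgroups, along isomorphisms and to direct products.\<close>

definition unique_prime_subgroup :: "('a, 'b) monoid_scheme \<Rightarrow> nat \<Rightarrow> bool" where
  "unique_prime_subgroup G p \<longleftrightarrow>
     (\<forall>x\<in>carrier G. \<forall>y\<in>carrier G. x \<noteq> \<one>\<^bsub>G\<^esub> \<longrightarrow> x [^]\<^bsub>G\<^esub> p = \<one>\<^bsub>G\<^esub> \<longrightarrow> y [^]\<^bsub>G\<^esub> p = \<one>\<^bsub>G\<^esub> \<longrightarrow>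
        (\<exists>k::int. y = x [^]\<^bsub>G\<^esub> k))"

section \<open>Congruences and geometric sums modulo a prime\<close>

lemma coprime_solve_dvd:
  fixes u n j :: int
  assumes "coprime u n"
  shows "\<exists>i. n dvd j + i * u"
proof -
  obtain x where "[u * x = 1] (mod n)" using cong_solve_coprime_int[OF assms] by blast
  then have "n dvd u * x - 1" by (simp add: cong_iff_dvd_diff)
  then have "n dvd - j * (u * x - 1)" by (rule dvd_mult)
  then have "n dvd j + (- j * x) * u" by (simp add: algebra_simps)
  then show ?thesis by blast
qed

text \<open>Modulo \<open>p\<^sup>2\<close> the power \<open>s ^ l\<close> is
  \<open>1 + l * (s - 1)\<close>, so the sum is \<open>p\<close> plus a multiple of
  \<open>p\<^sup>2\<close>, because \<open>(p - 1) / 2\<close> is an integer. The right side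
  displays \<open>p\<close> times a factor coprime to \<open>p\<close>. For \<open>p = 2\<close> and
  \<open>s = 3\<close> this fails, and here the quaternion groups slip through.\<close>

lemma geometric_sum_prime:
  fixes s :: int and p :: nat
  assumes "odd p" "int p dvd s - 1"
  shows "\<exists>e. (\<Sum>l<p. s ^ l) = int p * (1 + int p * e)"
proof -
  obtain t where "s - 1 = int p * t" using assms(2) by blast
  then have s: "s = 1 + int p * t" by simp
  have "\<exists>e. s ^ l = 1 + int l * int p * t + (int p)\<^sup>2 * e" for l
  proof (induction l)
    case (Suc l)
    then obtain e where "s ^ l = 1 + int l * int p * t + (int p)\<^sup>2 * e" by blast
    then have "s ^ Suc l = 1 + int (Suc l) * int p * t + (int p)\<^sup>2 * (int l * t * t + e + int p * t * e)"
      by (simp add: s algebra_simps power2_eq_square)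
    then show ?case by blast
  qed (auto intro: exI[of _ 0])
  then obtain e where e: "\<And>l. s ^ l = 1 + int l * int p * t + (int p)\<^sup>2 * e l" by metis
  obtain h where h: "p = 2 * h + 1" using assms(1) by (metis oddE)
  have gauss: "(\<Sum>l<2 * n + 1. int l) = int (2 * n + 1) * int n" for n
    by (induction n) (simp_all add: algebra_simps)
  have "(\<Sum>l<p. s ^ l) = int p + int p * t * (\<Sum>l<p. int l) + (int p)\<^sup>2 * (\<Sum>l<p. e l)"
    by (simp add: e sum.distrib sum_distrib_left sum_distrib_right algebra_simps)
  also have "(\<Sum>l<p. int l) = int p * int h" using gauss[of h] h by simp
  finally have "(\<Sum>l<p. s ^ l) = int p * (1 + int p * (t * int h + (\<Sum>l<p. e l)))"
    by (simp add: algebra_simps power2_eq_square)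
  then show ?thesis by blast
qed

text \<open>Fermat's little theorem for all integers, multiples of \<open>p\<close> and negative
  numbers included; \<open>fermat_theorem\<close> is applied to the least nonnegative residue
  \<open>r\<close>.\<close>

lemma prime_dvd_power_self_diff:
  fixes s :: int and p :: nat
  assumes "Factorial_Ring.prime p"
  shows "int p dvd s ^ p - s"
proof (cases "int p dvd s")
  case True
  then have "int p dvd s ^ p" using assms by (metis dvd_power dvd_trans prime_gt_0_nat)
  then show ?thesis using True by simp
next
  case False
  define r where "r = nat (s mod int p)"
  have p0: "p > 0" using assms prime_gt_0_nat by blast
  have r: "int r = s mod int p" using p0 by (simp add: r_def)
  have "\<not> p dvd r" using False r
    by (metis dvd_imp_mod_0 dvd_mod_iff dvd_refl int_dvd_int_iff mod_mod_trivial)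
  then have "[r ^ (p - 1) = 1] (mod p)" using fermat_theorem assms by blast
  then have "[int r ^ (p - 1) = 1] (mod int p)" by (metis cong_int_iff of_nat_1 of_nat_power)
  moreover have "[int r = s] (mod int p)" by (simp add: r)
  ultimately have "[s ^ (p - 1) = 1] (mod int p)" by (meson cong_pow cong_sym cong_trans)
  then have "[s ^ (p - 1) * s = 1 * s] (mod int p)" by (rule cong_scalar_right)
  moreover have "s ^ (p - 1) * s = s ^ p" using p0 by (simp add: power_eq_if)
  ultimately show ?thesis by (simp add: cong_iff_dvd_diff)
qed

section \<open>Powers in a cyclic group extended by a normalizing element\<close>

context group
begin

lemma conj_int_pow:
  assumes "w \<in> carrier G" "a \<in> carrier G"
  shows "(inv w \<otimes> a \<otimes> w) [^] (i::int) = inv w \<otimes> a [^] i \<otimes> w"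
proof -
  have "(\<lambda>x. inv w \<otimes> x \<otimes> w) \<in> hom G G"
    using assms by (auto simp: hom_def m_assoc inv_solve_left simp flip: m_assoc)
       (simp add: m_assoc inv_solve_left)
  from hom_int_pow[OF this assms(2) is_group is_group] show ?thesis by simp
qed

text \<open>Conjugation by \<open>w\<close> multiplies exponents of \<open>a\<close> by
  \<open>s\<close>, so iterating it yields powers of \<open>s\<close>.\<close>

lemma conj_pow_iterate:
  assumes [simp]: "w \<in> carrier G" "a \<in> carrier G" and s: "inv w \<otimes> a \<otimes> w = a [^] (s::int)"
  shows "inv (w [^] (k::nat)) \<otimes> a \<otimes> w [^] k = a [^] (s ^ k)"
proof (induction k)
  case (Suc k)
  have "inv (w [^] Suc k) \<otimes> a \<otimes> w [^] Suc k = inv w \<otimes> (inv (w [^] k) \<otimes> a \<otimes> w [^] k) \<otimes> w"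
    by (simp add: m_assoc inv_mult_group)
  also have "\<dots> = a [^] (s ^ Suc k)"
    unfolding Suc conj_int_pow[symmetric, OF assms(1,2)] s by (simp add: int_pow_pow)
  finally show ?case .
qed simp

text \<open>Moving a power of \<open>a\<close> to the right past \<open>w\<close> multiplies its
  exponent by \<open>s\<close>; collecting all of them behind \<open>w [^] k\<close> leaves a
  geometric sum.\<close>

lemma conj_mult_pow:
  assumes [simp]: "w \<in> carrier G" "a \<in> carrier G" and s: "inv w \<otimes> a \<otimes> w = a [^] (s::int)"
  shows "(w \<otimes> a [^] (i::int)) [^] (k::nat) = w [^] k \<otimes> a [^] (i * (\<Sum>l<k. s ^ l))"
proof (induction k)
  case (Suc k)
  have comm: "a [^] j \<otimes> w = w \<otimes> a [^] (s * j)" for j :: int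
    using conj_int_pow[OF assms(1,2), of j] s
    by (metis assms(1,2) int_pow_closed int_pow_pow inv_closed inv_solve_left m_assoc m_closed)
  have "(w \<otimes> a [^] i) [^] Suc k = w [^] k \<otimes> (a [^] (i * (\<Sum>l<k. s ^ l)) \<otimes> w) \<otimes> a [^] i"
    by (simp add: Suc m_assoc)
  also have "\<dots> = w [^] Suc k \<otimes> a [^] (s * (i * (\<Sum>l<k. s ^ l)) + i)"
    unfolding comm by (simp add: m_assoc int_pow_mult)
  also have "s * (i * (\<Sum>l<k. s ^ l)) + i = i * (\<Sum>l<Suc k. s ^ l)"
    unfolding sum.lessThan_Suc_shift by (simp add: sum_distrib_left algebra_simps)
  finally show ?case .
qed simp

text \<open>The formula for \<open>(w \<otimes> a [^] i) [^] p\<close> turns everything into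
  congruences modulo \<open>p ^ m\<close>. By uniqueness all elements of order \<open>p\<close> are
  powers of \<open>a\<close>, so this \<open>p\<close>-th power is never trivial. The assumption
  \<open>w_pm\<close>, available when \<open>a\<close> has maximal order, makes \<open>c\<close>
  divisible by \<open>p\<close>, so that a factor \<open>p\<close> can be cancelled.\<close>

lemma cyclic_extension:
  assumes aw[simp]: "a \<in> carrier G" "w \<in> carrier G"
    and p: "Factorial_Ring.prime p" and unique: "unique_prime_subgroup G p"
    and ord_a: "ord a = p ^ m" and w_pm: "w [^] (p ^ m) = \<one>"
    and s: "inv w \<otimes> a \<otimes> w = a [^] (s::int)"
    and c: "w [^] p = a [^] (c::int)" and w_notin: "w \<notin> range (\<lambda>n::int. a [^] n)"
  shows "p = 2" "m \<ge> 2" "inv w \<otimes> a \<otimes> w = inv a" "w \<otimes> w = a [^] (2 ^ (m - 1) :: nat)"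
proof -
  have p2: "p \<ge> 2" using p by (rule prime_ge_2_nat)
  have a_eq: "a [^] i = a [^] j \<longleftrightarrow> int p ^ m dvd j - i" for i j :: int
    using int_pow_eq[OF aw(1), of i j] by (simp add: ord_a)
  have a_eq1: "a [^] i = \<one> \<longleftrightarrow> int p ^ m dvd i" for i :: int
    using int_pow_eq_id[OF aw(1), of i] by (simp add: ord_a)
  have m0: "m \<noteq> 0"
  proof
    assume "m = 0"
    then have "w = a [^] (0::int)" using w_pm by simp
    then show False using w_notin by blast
  qed
  then have pm: "int p ^ m = int p * int p ^ (m - 1)" by (simp add: power_eq_if)
  \<comment> \<open>\<open>z\<close> generates the subgroup of order \<open>p\<close> inside the
    powers of \<open>a\<close>.\<close>
  define z where "z = a [^] (int p ^ (m - 1))"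
  have z: "z \<in> carrier G" by (simp add: z_def)
  have z1: "z \<noteq> \<one>" unfolding z_def a_eq1 pm using p2 by (auto dest: zdvd_imp_le)
  have zp: "z [^] p = \<one>"
    unfolding z_def by (simp add: int_pow_pow a_eq1 pm mult.commute flip: int_pow_int)
  have z_pow: "\<exists>i. y = a [^] (int p ^ (m - 1) * i)" if "y \<in> carrier G" "y [^] p = \<one>" for y
    using unique z z1 zp that unfolding unique_prime_subgroup_def z_def
    by (metis aw(1) int_pow_pow)
  have w_coset: "w \<otimes> a [^] i \<noteq> a [^] j" for i j :: int
  proof
    assume "w \<otimes> a [^] i = a [^] j"
    then have "w = a [^] (j - i)" by (simp add: int_pow_diff inv_solve_right)
    then show False using w_notin by blast
  qed
  have outside: "(w \<otimes> a [^] i) [^] p \<noteq> \<one>" for i :: int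
    using z_pow[of "w \<otimes> a [^] i"] w_coset by auto
  \<comment> \<open>Raising \<open>w [^] p = a [^] c\<close> to the power \<open>p ^ (m - 1)\<close>
    kills the left side, so \<open>p\<close> divides \<open>c\<close>.\<close>
  have "a [^] (c * int p ^ (m - 1)) = (w [^] p) [^] (p ^ (m - 1))"
    unfolding c by (simp add: int_pow_pow flip: int_pow_int)
  also have "\<dots> = \<one>" using w_pm m0 by (simp add: nat_pow_pow power_eq_if)
  finally have "int p dvd c" unfolding a_eq1 pm using p2 by simp
  then obtain j where j: "c = int p * j" by blast
  \<comment> \<open>\<open>w a\<^sup>i\<close> lies outside \<open>\<langle>a\<rangle>\<close>, so its \<open>p\<close>-th power is not 1.\<close>
  have key: "\<not> int p ^ m dvd int p * j + i * (\<Sum>l<p. s ^ l)" for i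
    using outside[of i] unfolding conj_mult_pow[OF aw(2,1) s] c j
    by (simp add: a_eq1 flip: int_pow_mult)
  \<comment> \<open>\<open>w [^] p\<close> is a power of \<open>a\<close> and commutes with it, so
    \<open>s ^ p\<close> is 1 modulo \<open>p ^ m\<close>; by Fermat \<open>s\<close> itself is 1
    modulo \<open>p\<close>.\<close>
  have "a [^] (s ^ p) = a [^] (1::int)"
    using conj_pow_iterate[OF aw(2,1) s, of p] unfolding c
    by (metis aw(1) int_pow_1 int_pow_closed int_pow_mult add.commute inv_solve_left m_assoc inv_closed m_closed)
  then have sp: "int p ^ m dvd s ^ p - 1" unfolding a_eq by (metis dvd_minus_iff minus_diff_eq)
  then have "int p dvd s ^ p - 1" using pm by (metis dvd_mult_left)
  then have ps: "int p dvd s - 1" using prime_dvd_power_self_diff[OF p, of s]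
    by (metis cong_iff_dvd_diff cong_sym cong_trans)
  \<comment> \<open>If the sum were \<open>p\<close> times a factor coprime to \<open>p\<close>, the
    congruence excluded by \<open>key\<close> could be solved for \<open>i\<close> after cancelling
    one \<open>p\<close>.\<close>
  have no_unit: "\<not> (\<Sum>l<p. s ^ l) = int p * (1 + int p * e)" for e
  proof
    assume S: "(\<Sum>l<p. s ^ l) = int p * (1 + int p * e)"
    have "coprime (1 + int p * e) (int p ^ (m - 1))"
      by (metis coprime_1_left coprime_add_one_left coprime_commute coprime_mult_left_iff
          coprime_power_right_iff add.commute)
    then obtain i where "int p ^ (m - 1) dvd j + i * (1 + int p * e)"
      using coprime_solve_dvd by blast
    then have "int p ^ m dvd int p * (j + i * (1 + int p * e))"
      unfolding pm by (rule mult_dvd_mono[OF dvd_refl])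
    then show False using key[of i] unfolding S by (simp add: algebra_simps)
  qed
  then have "even p" using geometric_sum_prime[OF _ ps] by blast
  then show p2': "p = 2" using p primes_dvd_imp_eq two_is_prime_nat by blast
  have S: "(\<Sum>l<p. s ^ l) = 1 + s" by (simp add: p2' numeral_2_eq_2)
  \<comment> \<open>With \<open>p = 2\<close> the sum is \<open>1 + s\<close>; were \<open>s\<close>
    equal to 1 modulo 4, it would have the form just excluded. Hence \<open>s - 1\<close> is twice
    an odd number \<open>f\<close>.\<close>
  have s4: "\<not> 4 dvd s - 1"
  proof
    assume "4 dvd s - 1"
    then obtain e where "s = 4 * e + 1" by (metis dvdE diff_eq_eq)
    then show False using no_unit[of e] S by (simp add: p2')
  qed
  have "even (s - 1)" using ps p2' by simp
  then obtain f where f: "s - 1 = 2 * f" by blast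
  with s4 have "odd f" by auto
  have odd_pow: "2 ^ m dvd 2 * (f * x) \<longleftrightarrow> 2 ^ m dvd 2 * x" for x :: int
  proof -
    have "coprime ((2::int) ^ m) f" using \<open>odd f\<close> by simp
    then show ?thesis by (metis coprime_dvd_mult_right_iff mult.left_commute)
  qed
  \<comment> \<open>\<open>w\<close> commutes with its square \<open>a [^] c\<close>, which gives
    \<open>2 ^ m dvd c * (s - 1)\<close>; the odd factor \<open>f\<close> then cancels.\<close>
  have "w \<otimes> a [^] c = a [^] c \<otimes> w"
    using c by (metis aw(2) nat_pow_Suc nat_pow_Suc2)
  then have "a [^] (c * s) = a [^] c"
    using conj_int_pow[OF aw(2,1), of c] s
    by (metis aw int_pow_closed int_pow_pow inv_solve_left mult.commute m_assoc inv_closed m_closed)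
  then have "2 ^ m dvd c * (s - 1)" unfolding a_eq p2'
    by (metis dvd_minus_iff minus_diff_eq mult.right_neutral of_nat_numeral right_diff_distrib)
  then have "2 ^ m dvd 2 * (f * c)" unfolding f by (simp add: ac_simps)
  then have c2: "2 ^ m dvd 2 * c" by (simp add: odd_pow)
  have c1: "\<not> 2 ^ m dvd c" using key[of 0] by (simp add: j p2')
  have ww: "w \<otimes> w = a [^] c" using c by (simp add: p2' numeral_2_eq_2)
  show m2: "m \<ge> 2"
  proof (rule ccontr)
    assume "\<not> m \<ge> 2"
    then have "m = 1" using m0 by simp
    then show False using c1 j p2' by simp
  qed
  \<comment> \<open>\<open>2 ^ (m - 1)\<close> is the only class of additive order 2 modulo
    \<open>2 ^ m\<close>.\<close>
  have inv_unique: "2 ^ m dvd x - y" if hyp: "2 ^ m dvd 2 * x" "\<not> 2 ^ m dvd x" "2 ^ m dvd 2 * y" "\<not> 2 ^ m dvd y"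
    for x y :: int
  proof -
    have mm: "(2::int) ^ m = 2 * 2 ^ (m - 1)" using pm by (simp add: p2')
    obtain x' y' where xy: "x = 2 ^ (m - 1) * x'" "y = 2 ^ (m - 1) * y'"
      using hyp(1,3) unfolding mm by (auto elim!: dvdE)
    then have "odd x'" "odd y'" using hyp(2,4) unfolding mm by (auto simp: mult.commute)
    then have "2 dvd x' - y'" by simp
    then have "2 ^ (m - 1) * 2 dvd 2 ^ (m - 1) * (x' - y')" by (rule mult_dvd_mono[OF dvd_refl])
    moreover have "x - y = 2 ^ (m - 1) * (x' - y')" by (simp add: xy right_diff_distrib)
    ultimately show ?thesis unfolding mm by (simp only: mult.commute)
  qed
  have "2 ^ m dvd (s - 1) * (s + 1)" using sp by (simp add: p2' power2_eq_square algebra_simps)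
  then have "2 ^ m dvd 2 * (f * (s + 1))" unfolding f by (simp add: ac_simps)
  then have s2: "2 ^ m dvd 2 * (s + 1)" by (simp add: odd_pow)
  \<comment> \<open>Otherwise \<open>s + 1\<close> and \<open>- c\<close> both represent that class,
    so \<open>c + (1 + s)\<close> vanishes modulo \<open>2 ^ m\<close>. Then
    \<open>w \<otimes> a\<close> squares to \<open>\<one>\<close>, contrary to \<open>key\<close>
    for \<open>i = 1\<close>.\<close>
  have "2 ^ m dvd s + 1"
  proof (rule ccontr)
    assume "\<not> 2 ^ m dvd s + 1"
    then have "2 ^ m dvd (s + 1) - (- c)" using inv_unique[of "s + 1" "- c"] s2 c1 c2 by simp
    then show False using key[of 1] S j p2' by (simp add: algebra_simps)
  qed
  then have "a [^] s = a [^] (-1::int)" unfolding a_eq p2'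
    by (metis ab_group_add_class.ab_diff_conv_add_uminus add.commute dvd_minus_iff minus_add_distrib of_nat_numeral minus_diff_eq diff_minus_eq_add)
  then show "inv w \<otimes> a \<otimes> w = inv a" using s by (simp add: int_pow_neg)
  have "2 ^ m dvd c - 2 ^ (m - 1)"
    using inv_unique[of c "2 ^ (m - 1)"] c1 c2 pm by (simp add: p2' dvd_imp_le_int)
  then show "w \<otimes> w = a [^] (2 ^ (m - 1) :: nat)"
    unfolding ww int_pow_int[symmetric] a_eq p2' by (simp add: dvd_diff_commute)
qed

end

section \<open>Groups of prime power order with a unique subgroup of prime order\<close>

text \<open>Growth of normalizers: for finite \<open>H\<close> the inclusion under conjugation is an
  equality, so \<open>g\<close> lies in the normalizer of \<open>H\<close>.\<close>

definition normalizer_condition :: "('a, 'b) monoid_scheme \<Rightarrow> bool" where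
  "normalizer_condition G \<longleftrightarrow>
     (\<forall>H. subgroup H G \<longrightarrow> H \<noteq> carrier G \<longrightarrow>
        (\<exists>g\<in>carrier G - H. \<forall>h\<in>H. inv\<^bsub>G\<^esub> g \<otimes>\<^bsub>G\<^esub> h \<otimes>\<^bsub>G\<^esub> g \<in> H))"

context group
begin

text \<open>Recognition by relations: \<open>h\<close> sends the normal form \<open>(i, s)\<close>
  to \<open>a [^] i\<close>, followed by \<open>w\<close> if \<open>s\<close> holds. The index is
  \<open>Suc m\<close> because the cyclic part of \<open>generalized_quaternion n\<close> has order
  \<open>2 ^ (n - 1)\<close>.\<close>

lemma generalized_quaternion_isoI:
  assumes aw[simp]: "a \<in> carrier G" "w \<in> carrier G"
    and ord_a: "ord a = 2 ^ m" and m: "m \<ge> 1"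
    and w_notin: "w \<notin> range (\<lambda>n::int. a [^] n)"
    and inverts: "inv w \<otimes> a \<otimes> w = inv a" and ww: "w \<otimes> w = a [^] (2 ^ (m - 1) :: nat)"
    and carr: "\<And>x. x \<in> carrier G \<Longrightarrow> \<exists>i::int. x = a [^] i \<or> x = a [^] i \<otimes> w"
  shows "G \<cong> generalized_quaternion (Suc m)"
proof -
  define Q where "Q = generalized_quaternion (Suc m)"
  define h where "h = (\<lambda>(i::int, s). a [^] i \<otimes> (if s then w else \<one>))"
  have a_eq: "a [^] i = a [^] j \<longleftrightarrow> 2 ^ m dvd j - i" for i j :: int
    using int_pow_eq[OF aw(1), of i j] by (simp add: ord_a)
  have a_mod: "a [^] (i mod 2 ^ m) = a [^] i" for i :: int
    unfolding a_eq by (simp add: minus_mod_eq_mult_div)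
  have Qgroup: "group Q" unfolding Q_def by (rule group_generalized_quaternion) (use m in simp)
  have carrQ: "carrier Q = {0..<2 ^ m} \<times> UNIV" by (simp add: Q_def generalized_quaternion_def)
  have multQ: "(i, s) \<otimes>\<^bsub>Q\<^esub> (j, t) =
      ((i + (if s then - j else j) + (if s \<and> t then 2 ^ (m - 1) else 0)) mod 2 ^ m, s \<noteq> t)" for i s j t
    by (simp add: Q_def generalized_quaternion_def)
  have wa: "w \<otimes> a [^] i = a [^] (- i) \<otimes> w" for i :: int
  proof -
    have "inv w \<otimes> a [^] (- i) \<otimes> w = a [^] i"
      using conj_int_pow[OF aw(2,1), of "- i"] unfolding inverts by (simp add: int_pow_inv int_pow_neg)
    then show ?thesis by (metis aw int_pow_closed inv_closed inv_solve_left m_assoc m_closed)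
  qed
  have "h \<in> hom Q G"
  proof (rule homI)
    fix x y assume "x \<in> carrier Q" "y \<in> carrier Q"
    obtain i s j t where xy: "x = (i, s)" "y = (j, t)" by (metis surj_pair)
    have ww': "w \<otimes> w = a [^] (2 ^ (m - 1) :: int)" using ww by (simp flip: int_pow_int)
    have "a [^] i \<otimes> w \<otimes> (a [^] j \<otimes> w) = a [^] (i + - j + 2 ^ (m - 1))"
    proof -
      have "a [^] i \<otimes> w \<otimes> (a [^] j \<otimes> w) = a [^] i \<otimes> (w \<otimes> a [^] j) \<otimes> w" by (simp add: m_assoc)
      also have "\<dots> = a [^] i \<otimes> a [^] (- j) \<otimes> (w \<otimes> w)" unfolding wa by (simp add: m_assoc)
      finally show ?thesis by (simp only: ww' int_pow_mult aw)
    qed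
    moreover have "a [^] i \<otimes> w \<otimes> a [^] j = a [^] (i + - j) \<otimes> w"
      by (simp only: m_assoc wa int_pow_mult aw int_pow_closed m_closed)
    ultimately show "h (x \<otimes>\<^bsub>Q\<^esub> y) = h x \<otimes> h y"
      by (cases s; cases t) (simp_all add: h_def xy multQ a_mod m_assoc int_pow_mult)
  qed (auto simp: h_def)
  moreover have "inj_on h (carrier Q)"
  proof (rule inj_onI)
    fix x y assume "x \<in> carrier Q" "y \<in> carrier Q" and eq: "h x = h y"
    then obtain i s j t where xy: "x = (i, s)" "y = (j, t)" "0 \<le> i" "i < 2 ^ m" "0 \<le> j" "j < 2 ^ m"
      by (auto simp: carrQ)
    have no: "a [^] k \<otimes> w \<noteq> a [^] l" for k l :: int
    proof
      assume "a [^] k \<otimes> w = a [^] l"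
      then have "w = inv (a [^] k) \<otimes> a [^] l" by (simp add: inv_solve_left)
      then have "w = a [^] (- k + l)" by (simp only: int_pow_mult int_pow_neg aw)
      then show False using w_notin by blast
    qed
    have "s = t" using eq no[of i j] no[of j i] by (cases s; cases t) (simp_all add: h_def xy)
    then have "a [^] i = a [^] j" using eq by (cases s) (simp_all add: h_def xy)
    then have "i mod 2 ^ m = j mod 2 ^ m" unfolding a_eq by (metis mod_eq_dvd_iff)
    then show "x = y" using xy \<open>s = t\<close> by simp
  qed
  moreover have "x \<in> h ` carrier Q" if x: "x \<in> carrier G" for x
  proof -
    obtain i :: int where "x = a [^] i \<or> x = a [^] i \<otimes> w" using carr[OF x] by blast
    then have "x = h (i mod 2 ^ m, False) \<or> x = h (i mod 2 ^ m, True)"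
      by (auto simp: h_def a_mod)
    then show ?thesis by (auto simp: carrQ)
  qed
  ultimately have "h \<in> iso Q G"
    by (auto simp: iso_iff hom_def)
  then have "Q \<cong> G" by (rule is_isoI)
  then show ?thesis unfolding Q_def[symmetric] using group.iso_sym[OF Qgroup] by blast
qed

text \<open>Maximality of \<open>ord a = p ^ m\<close> makes \<open>p ^ m\<close> an exponent of the
  whole group, as \<open>cyclic_extension\<close> requires. It then remains to show that the whole
  group normalizes \<open>A\<close>.\<close>

lemma p_group_unique_prime_subgroup:
  assumes fin: "finite (carrier G)" and nc: "normalizer_condition G"
    and p: "Factorial_Ring.prime p" and unique: "unique_prime_subgroup G p"
    and p_group: "\<And>x. x \<in> carrier G \<Longrightarrow> \<exists>i. x [^] (p ^ i) = \<one>"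
  shows "cyclic_group G \<and> (\<exists>k. order G = p ^ k) \<or> p = 2 \<and> (\<exists>n\<ge>3. G \<cong> generalized_quaternion n)"
proof -
  have "Max (ord ` carrier G) \<in> ord ` carrier G" using fin by (intro Max_in) auto
  then obtain a where a[simp]: "a \<in> carrier G" and "ord a = Max (ord ` carrier G)" by force
  then have max: "ord x \<le> ord a" if "x \<in> carrier G" for x using that fin by simp
  have ord_pow: "\<exists>i. ord x = p ^ i" if "x \<in> carrier G" for x
    using p_group[OF that] pow_eq_id[OF that] divides_primepow_nat[OF p] by metis
  obtain m where m: "ord a = p ^ m" using ord_pow a by blast
  have p2: "p \<ge> 2" using p by (rule prime_ge_2_nat)
  have pow_pm: "x [^] (p ^ m) = \<one>" if x: "x \<in> carrier G" for x
  proof -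
    obtain i where i: "ord x = p ^ i" using ord_pow x by blast
    then have "i \<le> m" using max[OF x] p2 m by (simp add: power_increasing_iff)
    then show ?thesis using x i by (simp add: pow_eq_id le_imp_power_dvd)
  qed
  have a_eq1: "a [^] i = \<one> \<longleftrightarrow> int p ^ m dvd i" for i :: int
    using int_pow_eq_id[OF a, of i] by (simp add: m)
  define A where "A = range (\<lambda>n::int. a [^] n)"
  have A: "subgroup A G" unfolding A_def by (rule subgroup_of_powers) simp
  interpret A: subgroup A G by (rule A)
  have aA: "a \<in> A" unfolding A_def by (metis a int_pow_1 rangeI)
  show ?thesis
  proof (cases "A = carrier G")
    case True
    then have "cyclic_group G" unfolding cyclic_group using a by (metis A_def)
    moreover have "order G = p ^ m"
      using cyclic_order_is_ord[OF a] carrier_subgroup_generated_by_singleton[OF a] m True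
      by (simp add: order_def A_def)
    ultimately show ?thesis by blast
  next
    case False
    \<comment> \<open>The \<open>p\<close>-th power of \<open>y\<close> need not lie in
      \<open>A\<close>. So the extension lemma is applied to \<open>w = y [^] (p ^ k)\<close>, the
      last iterated \<open>p\<close>-th power before the first one in \<open>A\<close>, and
      \<open>k = 0\<close> is deduced afterwards.\<close>
    have step: "p = 2 \<and> m \<ge> 2 \<and> inv y \<otimes> a \<otimes> y = inv a \<and> y \<otimes> y = a [^] (2 ^ (m - 1) :: nat)"
      if y: "y \<in> carrier G" "y \<notin> A" "inv y \<otimes> a \<otimes> y \<in> A" for y
    proof -
      obtain s :: int where s: "inv y \<otimes> a \<otimes> y = a [^] s" using y(3) by (auto simp: A_def)
      define K where "K = (LEAST i. y [^] (p ^ i) \<in> A)"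
      have "y [^] (p ^ m) \<in> A" using pow_pm[OF y(1)] by simp
      then have K: "y [^] (p ^ K) \<in> A" and least: "\<And>k. y [^] (p ^ k) \<in> A \<Longrightarrow> K \<le> k"
        unfolding K_def by (auto intro: LeastI Least_le)
      have "K \<noteq> 0" using K y by (cases K) auto
      then obtain k where k: "K = Suc k" by (metis not0_implies_Suc)
      define w where "w = y [^] (p ^ k)"
      have w: "w \<in> carrier G" using y by (simp add: w_def)
      have wp: "w [^] p \<in> A" using K y by (simp add: w_def k nat_pow_pow mult.commute)
      have wA: "w \<notin> A" using least[of k] by (auto simp: w_def k)
      obtain c :: int where c: "w [^] p = a [^] c" using wp by (auto simp: A_def)
      have conj: "inv w \<otimes> a \<otimes> w = a [^] (s ^ (p ^ k))"
        unfolding w_def by (rule conj_pow_iterate[OF y(1) a s])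
      note ext = cyclic_extension[OF a w p unique m pow_pm[OF w] conj c wA[unfolded A_def]]
      \<comment> \<open>For positive \<open>k\<close> conjugation by \<open>w\<close> would be the
        square of conjugation by a power of \<open>y\<close>, making -1 a square modulo 4.\<close>
      have "k = 0"
      proof (rule ccontr)
        assume "k \<noteq> 0"
        then obtain k' where k': "k = Suc k'" by (metis not0_implies_Suc)
        define t where "t = s ^ (2 ^ k')"
        have "s ^ (p ^ k) = t\<^sup>2"
          by (simp add: ext(1) k' t_def mult.commute flip: power_mult)
        then have "a [^] (t\<^sup>2 + 1) = \<one>" using ext(3) conj by (simp add: int_pow_mult)
        then have "2 ^ m dvd t\<^sup>2 + 1" using ext(1) by (simp add: a_eq1)
        moreover have "(2::int) ^ 2 dvd 2 ^ m" using ext(2) by (rule le_imp_power_dvd)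
        ultimately have "2 ^ 2 dvd t\<^sup>2 + 1" by (rule dvd_trans[rotated])
        then have "4 dvd t\<^sup>2 + 1" by simp
        moreover have "\<not> 4 dvd t\<^sup>2 + 1"
        proof (cases "even t")
          case True
          then have "odd (t\<^sup>2 + 1)" by simp
          then show ?thesis by (metis dvd_trans even_numeral)
        next
          case False
          then obtain v where v: "t = 2 * v + 1" by (metis oddE)
          have "t\<^sup>2 + 1 = 4 * (v\<^sup>2 + v) + 2" unfolding v by (simp add: power2_eq_square algebra_simps)
          then show ?thesis by presburger
        qed
        ultimately show False by blast
      qed
      then have "w = y" using y by (simp add: w_def)
      then show ?thesis using ext by simp
    qed
    \<comment> \<open>Both factors invert \<open>a\<close>, so the product centralizes
      \<open>a\<close>. Outside \<open>A\<close> it would also invert \<open>a\<close>,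
      contradicting that \<open>a\<close> has order at least 4. Hence \<open>A\<close> has index at
      most 2 in its normalizer.\<close>
    have prod_in: "x \<otimes> y \<in> A"
      if x: "x \<in> carrier G" "x \<notin> A" "inv x \<otimes> a \<otimes> x \<in> A"
        and y: "y \<in> carrier G" "y \<notin> A" "inv y \<otimes> a \<otimes> y \<in> A" for x y
    proof (rule ccontr)
      assume xy: "x \<otimes> y \<notin> A"
      have "inv (x \<otimes> y) \<otimes> a \<otimes> (x \<otimes> y) = inv y \<otimes> (inv x \<otimes> a \<otimes> x) \<otimes> y"
        using x y by (simp add: inv_mult_group m_assoc)
      also have "\<dots> = inv y \<otimes> inv a \<otimes> y" using step[OF x] by simp
      also have "\<dots> = inv (inv y \<otimes> a \<otimes> y)" using y by (simp add: inv_mult_group m_assoc)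
      also have "\<dots> = a" using step[OF y] by simp
      finally have conj: "inv (x \<otimes> y) \<otimes> a \<otimes> (x \<otimes> y) = a" .
      then have st: "p = 2" "m \<ge> 2" "a = inv a" using step[of "x \<otimes> y"] x y xy aA by simp_all
      have "a [^] (2::int) = \<one>"
        using st(3) by (metis a int_pow_1 int_pow_mult one_add_one r_inv)
      then have "2 ^ m dvd (2::int)" using st by (simp add: a_eq1)
      moreover have "(2::int) ^ 2 dvd 2 ^ m" using st(2) by (rule le_imp_power_dvd)
      ultimately have "(2::int) ^ 2 dvd 2" by (metis dvd_trans)
      then show False by simp
    qed
    obtain w where w: "w \<in> carrier G" "w \<notin> A" "inv w \<otimes> a \<otimes> w \<in> A"
      using nc A False aA unfolding normalizer_condition_def by blast
    note st = step[OF w]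
    have p_2: "p = 2" and m2: "m \<ge> 2" using st by auto
    define z where "z = a [^] (2 ^ (m - 1) :: nat)"
    have z: "z \<in> carrier G" by (simp add: z_def)
    have zA: "z \<in> A" unfolding z_def by (metis A_def int_pow_int rangeI)
    have z1: "z \<noteq> \<one>"
    proof
      assume "z = \<one>"
      then have "2 ^ m dvd (2::nat) ^ (m - 1)" using pow_eq_id[OF a] m p_2 by (simp add: z_def)
      then show False using m2 by (auto dest!: power_dvd_imp_le)
    qed
    have zz: "z [^] (2::nat) = \<one>"
      using pow_pm[OF a] m2 p_2 by (simp add: z_def nat_pow_pow power_eq_if mult.commute)
    \<comment> \<open>By the fact \<open>step\<close> this is the normalizer of \<open>\<langle>a\<rangle>\<close>.\<close>
    define N where "N = {g \<in> carrier G. inv g \<otimes> a \<otimes> g = a \<or> inv g \<otimes> a \<otimes> g = inv a}"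
    have AN: "x \<in> N" if xA: "x \<in> A" for x
    proof -
      obtain i :: int where x: "x = a [^] i" using xA by (auto simp: A_def)
      have comm: "a \<otimes> x = x \<otimes> a" unfolding x by (metis a int_pow_1 int_pow_mult add.commute)
      have "inv x \<otimes> a \<otimes> x = inv x \<otimes> x \<otimes> a"
        using A.mem_carrier[OF xA] by (simp only: m_assoc a inv_closed comm)
      then show ?thesis using A.mem_carrier[OF xA] by (simp add: N_def)
    qed
    have N_norm: "inv g \<otimes> a \<otimes> g \<in> A" if "g \<in> N" for g
      using that aA by (auto simp: N_def)
    have norm_N: "g \<in> N" if g: "g \<in> carrier G" "inv g \<otimes> a \<otimes> g \<in> A" for g
    proof (cases "g \<in> A")
      case False
      then show ?thesis using step[OF g(1) _ g(2)] g(1) by (simp add: N_def)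
    qed (rule AN)
    have conj_inv: "inv g \<otimes> inv a \<otimes> g = inv (inv g \<otimes> a \<otimes> g)" if "g \<in> carrier G" for g
      using that by (simp add: inv_mult_group m_assoc)
    have N: "subgroup N G"
    proof (rule subgroupI)
      show "N \<noteq> {}" using AN aA by blast
    next
      fix x y assume xy: "x \<in> N" "y \<in> N"
      then have "inv (x \<otimes> y) \<otimes> a \<otimes> (x \<otimes> y) = inv y \<otimes> (inv x \<otimes> a \<otimes> x) \<otimes> y"
        by (simp add: N_def inv_mult_group m_assoc)
      then show "x \<otimes> y \<in> N" using xy by (auto simp: N_def conj_inv)
    next
      fix x assume x: "x \<in> N"
      then have xc: "x \<in> carrier G" by (simp add: N_def)
      have "x \<otimes> (inv x \<otimes> a \<otimes> x) \<otimes> inv x = x \<otimes> inv x \<otimes> a \<otimes> (x \<otimes> inv x)" using xc by (simp only: m_assoc a inv_closed m_closed)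
      then have "x \<otimes> (inv x \<otimes> a \<otimes> x) \<otimes> inv x = a" using xc by simp
      then have "inv (inv x) \<otimes> a \<otimes> inv x = a \<or> inv (inv x) \<otimes> inv a \<otimes> inv x = a"
        using x xc by (auto simp: N_def)
      then have "inv (inv x) \<otimes> a \<otimes> inv x = a \<or> inv (inv (inv x) \<otimes> a \<otimes> inv x) = a"
        using conj_inv[of "inv x"] xc by simp
      moreover have "inv (inv x) \<otimes> a \<otimes> inv x \<in> carrier G" using xc by simp
      ultimately have "inv (inv x) \<otimes> a \<otimes> inv x = a \<or> inv (inv x) \<otimes> a \<otimes> inv x = inv a"
        by (metis inv_inv)
      then show "inv x \<in> N" using xc by (simp add: N_def)
    qed (auto simp: N_def)
    \<comment> \<open>Otherwise a conjugate \<open>j\<close> of \<open>a\<close> lies in \<open>N - A\<close> and thus has order 4; then all squares lie in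
      \<open>A\<close>, which puts \<open>j\<close> into \<open>A\<close>.\<close>
    have "N = carrier G"
    proof (rule ccontr)
      assume "N \<noteq> carrier G"
      \<comment> \<open>\<open>g\<close> normalizes \<open>N\<close> but not
        \<open>A\<close>.\<close>
      then obtain g where g: "g \<in> carrier G" "g \<notin> N" and gN: "\<And>x. x \<in> N \<Longrightarrow> inv g \<otimes> x \<otimes> g \<in> N"
        using nc N unfolding normalizer_condition_def by blast
      define j where "j = inv g \<otimes> a \<otimes> g"
      have jN: "j \<in> N" unfolding j_def using gN AN aA by blast
      have jA: "j \<notin> A" using norm_N g unfolding j_def by blast
      have jc[simp]: "j \<in> carrier G" using g by (simp add: j_def)
      have "j [^] (4::nat) = (j \<otimes> j) [^] (2::nat)"
        by (simp add: numeral_eq_Suc m_assoc)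
      also have "j \<otimes> j = z" using step[OF jc jA N_norm[OF jN]] by (simp add: z_def)
      also note zz
      finally have "j [^] (int 4) = \<one>" by (simp only: int_pow_int)
      then have "inv g \<otimes> a [^] (int 4) \<otimes> g = \<one>"
        unfolding j_def conj_int_pow[OF g(1) a] .
      then have "inv g = inv g \<otimes> a [^] (int 4)" using g by (intro inv_equality) simp_all
      then have "a [^] (int 4) = \<one>" using g by (simp add: l_cancel_one')
      then have "ord a dvd 4" by (simp only: int_pow_int pow_eq_id a)
      then have "2 ^ m dvd (2::nat) ^ 2" using m p_2 by simp
      then have "m = 2" using m2 power_dvd_imp_le[of 2 m 2] by simp
      \<comment> \<open>The group now has exponent 4, so the square of a square is trivial and
        uniqueness makes squares powers of \<open>z\<close>.\<close>
      have sq: "x \<otimes> x \<in> A" if x: "x \<in> carrier G" for x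
      proof -
        have "(x \<otimes> x) [^] (2::nat) = \<one>"
          using pow_pm[OF x] x by (simp add: p_2 \<open>m = 2\<close> numeral_eq_Suc m_assoc)
        then obtain k :: int where "x \<otimes> x = z [^] k"
          using unique z z1 zz x unfolding unique_prime_subgroup_def p_2 by blast
        then show ?thesis using subgroup_int_pow_closed[OF A zA] by simp
      qed
      \<comment> \<open>Writing \<open>a g a g\<close> as
        \<open>a g\<^sup>2 (g\<^sup>-\<^sup>1 a g)\<close> expresses \<open>j\<close> through
        \<open>a\<close> and two squares.\<close>
      have "(a \<otimes> g) \<otimes> (a \<otimes> g) = a \<otimes> (g \<otimes> g) \<otimes> j"
      proof -
        have "a \<otimes> (g \<otimes> g) \<otimes> j = a \<otimes> g \<otimes> (g \<otimes> inv g) \<otimes> (a \<otimes> g)"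
          unfolding j_def using g(1) by (simp only: m_assoc a inv_closed m_closed)
        then show ?thesis using g(1) by simp
      qed
      then have "j = inv (a \<otimes> (g \<otimes> g)) \<otimes> ((a \<otimes> g) \<otimes> (a \<otimes> g))"
        using g(1) by (simp add: inv_solve_left)
      then have "j \<in> A" using sq[of g] sq[of "a \<otimes> g"] g(1) aA by simp
      then show False using jA by blast
    qed
    then have norm: "inv x \<otimes> a \<otimes> x \<in> A" if "x \<in> carrier G" for x using N_norm that by blast
    have "G \<cong> generalized_quaternion (Suc m)"
    proof (rule generalized_quaternion_isoI[OF a w(1)])
      show "ord a = 2 ^ m" using m p_2 by simp
      fix x assume x: "x \<in> carrier G"
      show "\<exists>i::int. x = a [^] i \<or> x = a [^] i \<otimes> w"
      proof (cases "x \<in> A")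
        case True
        then show ?thesis by (auto simp: A_def)
      next
        case False
        have "inv w \<notin> A" using w by (metis A.m_inv_closed inv_inv)
        then have "x \<otimes> inv w \<in> A" using prod_in x False norm w(1) by simp
        then obtain i :: int where "x \<otimes> inv w = a [^] i" by (auto simp: A_def)
        then have "x = a [^] i \<otimes> w" using x w(1) by (metis a int_pow_closed inv_closed inv_inv inv_solve_right)
        then show ?thesis by blast
      qed
    qed (use st w m2 in \<open>auto simp: A_def\<close>)
    then show ?thesis using p_2 m2 by (intro disjI2 conjI exI[of _ "Suc m"]) auto
  qed
qed

end

section \<open>Triangles of subgroups\<close>

text \<open>The case \<open>p = q\<close> is allowed, so that groups with one relevant prime, or
  none, are covered as well.\<close>

definition few_prime_subgroups :: "('a, 'b) monoid_scheme \<Rightarrow> nat \<Rightarrow> nat \<Rightarrow> bool" where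
  "few_prime_subgroups G p q \<longleftrightarrow> unique_prime_subgroup G p \<and> unique_prime_subgroup G q \<and>
     (\<forall>x\<in>carrier G. \<exists>i j. x [^]\<^bsub>G\<^esub> (p ^ i * q ^ j) = \<one>\<^bsub>G\<^esub>)"

lemma product_of_two_prime_powers:
  fixes n :: nat
  assumes "n > 0" "\<And>r. Factorial_Ring.prime r \<Longrightarrow> r dvd n \<Longrightarrow> r = p \<or> r = q"
  shows "\<exists>i j. n = p ^ i * q ^ j"
  using assms
proof (induction n rule: less_induct)
  case (less n)
  show ?case
  proof (cases "n = 1")
    case True
    then have "n = p ^ 0 * q ^ 0" by simp
    then show ?thesis by blast
  next
    case False
    then obtain r where r: "Factorial_Ring.prime r" "r dvd n" using prime_factor_nat by blast
    then obtain k where k: "n = r * k" by blast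
    have "k < n" "k > 0" using k less.prems(1) prime_gt_1_nat[OF r(1)] by auto
    moreover have "s = p \<or> s = q" if "Factorial_Ring.prime s" "s dvd k" for s
      using less.prems(2) that k by simp
    ultimately obtain i j where "k = p ^ i * q ^ j" using less.IH by blast
    then have "n = p ^ Suc i * q ^ j \<or> n = p ^ i * q ^ Suc j"
      using less.prems(2)[OF r] k by auto
    then show ?thesis by blast
  qed
qed

context group
begin

text \<open>Three nontrivial subgroups meeting pairwise trivially are automatically distinct, and
  each makes the others vertices. After this lemma the graph no longer occurs.\<close>

lemma triangle_free_intersection_subgroup_graph_iff:
  assumes fin: "finite (carrier G)"
  shows "triangle_free (with_proj (intersection_subgroup_graph G)) \<longleftrightarrow>
    (\<nexists>A B C. subgroup A G \<and> subgroup B G \<and> subgroup C G \<and>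
       A \<noteq> {\<one>} \<and> B \<noteq> {\<one>} \<and> C \<noteq> {\<one>} \<and> A \<inter> B = {\<one>} \<and> A \<inter> C = {\<one>} \<and> B \<inter> C = {\<one>})"
    (is "_ \<longleftrightarrow> \<not> ?tri")
proof -
  let ?\<Gamma> = "intersection_subgroup_graph G"
  interpret \<Gamma>: pair_graph ?\<Gamma> by (rule graph_intersection_subgroup_graph[OF fin])
  have vertI: "H \<in> pverts ?\<Gamma>"
    if "subgroup H G" "H \<noteq> {\<one>}" "subgroup K G" "K \<noteq> {\<one>}" "H \<inter> K = {\<one>}" for H K
    using that unfolding intersection_subgroup_graph_def Let_def by simp blast
  have arc_iff: "(H, K) \<in> parcs ?\<Gamma> \<longleftrightarrow> H \<in> pverts ?\<Gamma> \<and> K \<in> pverts ?\<Gamma> \<and> H \<noteq> K \<and> H \<inter> K = {\<one>}" for H K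
    unfolding intersection_subgroup_graph_def Let_def by simp
  have "\<exists>T. subgraph T (with_proj ?\<Gamma>) \<and> K\<^bsub>3\<^esub> T" if tri: ?tri
  proof -
    obtain A B C where ABC: "subgroup A G" "subgroup B G" "subgroup C G"
      "A \<noteq> {\<one>}" "B \<noteq> {\<one>}" "C \<noteq> {\<one>}" "A \<inter> B = {\<one>}" "A \<inter> C = {\<one>}" "B \<inter> C = {\<one>}"
      using tri by blast
    then have ne: "A \<noteq> B" "A \<noteq> C" "B \<noteq> C" by auto
    \<comment> \<open>The complete graph on the three subgroups, each edge being represented by both
      ordered pairs.\<close>
    define T where "T = \<lparr>pverts = {A, B, C}, parcs = {(u, v). (u, v) \<in> {A, B, C} \<times> {A, B, C} \<and> u \<noteq> v}\<rparr>"
    have K: "K\<^bsub>3\<^esub> (with_proj T)"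
      unfolding complete_digraph_pair_def by (simp add: T_def ne)
    interpret T: graph "with_proj T" using K by (simp add: complete_digraph_def)
    have comm: "B \<inter> A = {\<one>}" "C \<inter> A = {\<one>}" "C \<inter> B = {\<one>}" using ABC by blast+
    have V: "A \<in> pverts ?\<Gamma>" "B \<in> pverts ?\<Gamma>" "C \<in> pverts ?\<Gamma>"
      using vertI[OF ABC(1,4,2,5,7)] vertI[OF ABC(2,5,1,4) comm(1)] vertI[OF ABC(3,6,1,4) comm(2)] .
    have "parcs T \<subseteq> parcs ?\<Gamma>"
      unfolding T_def by (auto simp: arc_iff V ABC(7-9) comm)
    then have "subgraph (with_proj T) (with_proj ?\<Gamma>)"
      unfolding subgraph_def using V \<Gamma>.wf_digraph_axioms T.wf_digraph_axioms
      by (auto simp: T_def compatible_def)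
    with K show ?thesis by blast
  qed
  moreover have ?tri if T: "subgraph T (with_proj ?\<Gamma>)" "K\<^bsub>3\<^esub> T" for T
  proof -
    have "card (verts T) = 3" using T(2) by (simp add: complete_digraph_def)
    then obtain A B C where ABC: "verts T = {A, B, C}" "A \<noteq> B" "A \<noteq> C" "B \<noteq> C"
      by (auto simp: card_3_iff)
    have arc: "u \<inter> v = {\<one>}" if uv: "u \<in> verts T" "v \<in> verts T" "u \<noteq> v" for u v
    proof -
      have "(u, v) \<in> arcs_ends T" using T(2) uv by (auto simp: complete_digraph_def)
      then obtain e where e: "e \<in> arcs T" "tail T e = u" "head T e = v"
        by (auto simp: arcs_ends_conv)
      moreover have "tail T = fst" "head T = snd" "arcs T \<subseteq> parcs ?\<Gamma>"
        using T(1) by (auto simp: subgraph_def compatible_def)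
      ultimately have "(u, v) \<in> parcs ?\<Gamma>" by (metis prod.collapse subsetD)
      then show ?thesis by (auto simp: intersection_subgroup_graph_def Let_def)
    qed
    have "verts T \<subseteq> pverts ?\<Gamma>" using T(1) by (auto simp: subgraph_def)
    then have "subgroup u G \<and> u \<noteq> {\<one>}" if "u \<in> verts T" for u
      using that by (auto simp: intersection_subgroup_graph_def Let_def)
    then show ?tri using arc ABC by (intro exI[of _ A] exI[of _ B] exI[of _ C]) simp
  qed
  ultimately show ?thesis unfolding triangle_free_def by blast
qed

section \<open>Elements and subgroups of prime order\<close>

lemma int_pow_generates:
  assumes y: "y \<in> carrier G" and p: "Factorial_Ring.prime (p::nat)" and yp: "y [^] p = \<one>"
    and ne: "y [^] (k::int) \<noteq> \<one>"
  shows "\<exists>l::int. y = (y [^] k) [^] l"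
proof -
  have ord: "int (ord y) dvd int p" using yp pow_eq_id[OF y] by simp
  have "\<not> int p dvd k" using ne ord int_pow_eq_id[OF y] dvd_trans by blast
  then have "coprime k (int p)"
    using p by (metis coprime_commute prime_imp_coprime prime_nat_int_transfer)
  then obtain l where "int p dvd - 1 + l * k" using coprime_solve_dvd by blast
  then have "int (ord y) dvd k * l - 1" using ord by (metis dvd_trans mult.commute add.commute uminus_add_conv_diff)
  then have "y [^] (1::int) = y [^] (k * l)" unfolding int_pow_eq[OF y] .
  then show ?thesis using y by (metis int_pow_1 int_pow_pow)
qed

text \<open>A nontrivial power of \<open>y\<close> generates \<open>y\<close> again, so a subgroup
  that meets the powers of \<open>y\<close> nontrivially contains \<open>y\<close>.\<close>

lemma subgroup_inter_powers_trivial: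
  assumes S: "subgroup S G" and y: "y \<in> carrier G" "y \<notin> S"
    and p: "Factorial_Ring.prime (p::nat)" and yp: "y [^] p = \<one>"
  shows "S \<inter> range (\<lambda>n::int. y [^] n) = {\<one>}"
proof -
  have "y [^] k = \<one>" if "y [^] k \<in> S" for k :: int
    using int_pow_generates[OF y(1) p yp] subgroup_int_pow_closed[OF S that] y(2) by metis
  moreover have "\<one> \<in> range (\<lambda>n::int. y [^] n)" by (metis int_pow_0 rangeI)
  ultimately show ?thesis using subgroup.one_closed[OF S] by auto
qed

lemma mem_powers: "x \<in> carrier G \<Longrightarrow> x \<in> range (\<lambda>n::int. x [^] n)"
  by (metis int_pow_1 rangeI)

lemma prime_order_element:
  assumes x: "x \<in> carrier G" and r: "Factorial_Ring.prime (r::nat)" "r dvd ord x" and nz: "ord x \<noteq> 0"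
  shows "x [^] (ord x div r) \<noteq> \<one>" "(x [^] (ord x div r)) [^] r = \<one>"
proof -
  obtain k where k: "ord x = r * k" using r(2) by blast
  then have "k > 0" "r > 1" using nz prime_gt_1_nat[OF r(1)] by auto
  then have "\<not> ord x dvd k" using k by (auto dest: dvd_imp_le)
  then show "x [^] (ord x div r) \<noteq> \<one>" using k x \<open>r > 1\<close> by (simp add: pow_eq_id)
  show "(x [^] (ord x div r)) [^] r = \<one>"
    using k x \<open>r > 1\<close> by (simp add: nat_pow_pow mult.commute pow_eq_id)
qed

text \<open>Uniqueness for each prime comes first, with a conjugate or diagonal subgroup as third
  vertex. Then the set \<open>PS\<close> of orders that are prime has at most two members, since
  elements of different prime orders generate subgroups that meet trivially.\<close>

lemma few_prime_subgroups_if_no_triangle: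
  assumes fin: "finite (carrier G)"
    and no_tri: "\<And>A B C. \<lbrakk>subgroup A G; subgroup B G; subgroup C G; A \<noteq> {\<one>}; B \<noteq> {\<one>}; C \<noteq> {\<one>};
       A \<inter> B = {\<one>}; A \<inter> C = {\<one>}; B \<inter> C = {\<one>}\<rbrakk> \<Longrightarrow> False"
  shows "\<exists>p q. Factorial_Ring.prime p \<and> Factorial_Ring.prime q \<and> few_prime_subgroups G p q"
proof -
  define P where "P = (\<lambda>x. range (\<lambda>n::int. x [^] n))"
  have P: "subgroup (P x) G" "x \<in> P x" if "x \<in> carrier G" for x
    using subgroup_of_powers[OF that] mem_powers[OF that] by (simp_all add: P_def)
  have disj: "S \<inter> P y = {\<one>}"
    if "subgroup S G" "y \<in> carrier G" "y \<notin> S" "Factorial_Ring.prime p" "y [^] p = \<one>" for S y and p :: nat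
    using subgroup_inter_powers_trivial[OF that] by (simp add: P_def)
  \<comment> \<open>It is enough that each later element, being of prime order, lies outside the
    earlier subgroups; \<open>disj\<close> turns this into trivial intersections. \<open>x\<close>
    may have any order.\<close>
  have three: False
    if "x \<in> carrier G" "y \<in> carrier G" "z \<in> carrier G"
      and "Factorial_Ring.prime q" "Factorial_Ring.prime r" "y [^] q = \<one>" "z [^] r = \<one>"
      and "x \<noteq> \<one>" "y \<notin> P x" "z \<notin> P x" "z \<notin> P y" for x y z and q r :: nat
  proof -
    have "\<one> \<in> P x" using P(1)[OF \<open>x \<in> carrier G\<close>] by (rule subgroup.one_closed)
    then have "y \<noteq> \<one>" "z \<noteq> \<one>" using that by auto
    then have ne: "P x \<noteq> {\<one>}" "P y \<noteq> {\<one>}" "P z \<noteq> {\<one>}" using P(2) that by auto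
    have "P x \<inter> P y = {\<one>}" "P x \<inter> P z = {\<one>}" "P y \<inter> P z = {\<one>}"
      using disj[OF P(1)[OF that(1)] that(2,9,4,6)] disj[OF P(1)[OF that(1)] that(3,10,5,7)]
        disj[OF P(1)[OF that(2)] that(3,11,5,7)] by auto
    then show False by (rule no_tri[OF P(1)[OF that(1)] P(1)[OF that(2)] P(1)[OF that(3)] ne])
  qed
  have unique: "unique_prime_subgroup G p" if p: "Factorial_Ring.prime p" for p :: nat
    unfolding unique_prime_subgroup_def
  proof (intro ballI impI)
    fix x y assume x: "x \<in> carrier G" and y: "y \<in> carrier G"
      and x1: "x \<noteq> \<one>" and xp: "x [^] p = \<one>" and yp: "y [^] p = \<one>"
    show "\<exists>k::int. y = x [^] k"
    proof (rule ccontr)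
      assume "\<not> ?thesis"
      then have yx: "y \<notin> P x" by (auto simp: P_def)
      interpret S: subgroup "P x" G by (rule P(1)[OF x])
      interpret Y: subgroup "P y" G by (rule P(1)[OF y])
      have xy: "x \<notin> P y" using disj[OF P(1)[OF x] y yx p yp] P(2)[OF x] x1 by auto
      \<comment> \<open>If \<open>u\<close> does not normalize the powers of \<open>v\<close>, then
        \<open>v\<close>, \<open>u\<close> and the conjugate of \<open>v\<close> generate three
        subgroups that meet pairwise trivially.\<close>
      have conj: "inv u \<otimes> v \<otimes> u \<in> P v"
        if uv: "u \<in> carrier G" "v \<in> carrier G" "u [^] p = \<one>" "v [^] p = \<one>" "v \<noteq> \<one>" "u \<notin> P v" for u v
      proof (rule ccontr)
        assume out: "inv u \<otimes> v \<otimes> u \<notin> P v"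
        interpret V: subgroup "P v" G by (rule P(1)[OF uv(2)])
        interpret U: subgroup "P u" G by (rule P(1)[OF uv(1)])
        have "u \<in> P u" "v \<in> P v" using P(2) uv by auto
        have vu: "v \<notin> P u" using disj[OF P(1)[OF uv(2)] uv(1,6) p uv(3)] \<open>v \<in> P v\<close> uv(5) by auto
        have out2: "inv u \<otimes> v \<otimes> u \<notin> P u"
        proof
          assume "inv u \<otimes> v \<otimes> u \<in> P u"
          then have "u \<otimes> (inv u \<otimes> v \<otimes> u) \<otimes> inv u \<in> P u" using \<open>u \<in> P u\<close> by blast
          moreover have "u \<otimes> (inv u \<otimes> v \<otimes> u) \<otimes> inv u = (u \<otimes> inv u) \<otimes> v \<otimes> (u \<otimes> inv u)"
            using uv by (simp only: m_assoc m_closed inv_closed)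
          ultimately show False using uv vu by simp
        qed
        have "(inv u \<otimes> v \<otimes> u) [^] (int p) = \<one>"
          unfolding conj_int_pow[OF uv(1,2)] using uv by (simp add: int_pow_int)
        then have "(inv u \<otimes> v \<otimes> u) [^] p = \<one>" by (simp add: int_pow_int)
        then show False using three[of v u "inv u \<otimes> v \<otimes> u" p p] uv p out out2 by simp
      qed
      have y1: "y \<noteq> \<one>" using yx S.one_closed by auto
      have "inv x \<otimes> y \<otimes> x \<in> P y" "inv y \<otimes> x \<otimes> y \<in> P x"
        using conj[of x y] conj[of y x] x y xp yp x1 y1 xy yx by auto
      \<comment> \<open>The commutator of \<open>x\<close> and \<open>y\<close> lies in both
        subgroups, as each element normalizes the subgroup of the other, and is therefore
        trivial.\<close>
      then have "inv x \<otimes> (inv y \<otimes> x \<otimes> y) \<in> P x" "inv (inv x \<otimes> y \<otimes> x) \<otimes> y \<in> P y"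
        using P(2) x y by blast+
      moreover have "inv (inv x \<otimes> y \<otimes> x) \<otimes> y = inv x \<otimes> (inv y \<otimes> x \<otimes> y)"
        using x y by (simp add: inv_mult_group m_assoc)
      ultimately have "inv x \<otimes> (inv y \<otimes> x \<otimes> y) = \<one>"
        using disj[OF P(1)[OF x] y yx p yp] by auto
      then have "inv y \<otimes> (x \<otimes> y) = x"
        using x y by (metis inv_closed inv_inv inv_solve_left inv_unique' m_assoc m_closed r_one)
      then have comm: "x \<otimes> y = y \<otimes> x" using x y by (metis inv_solve_left m_closed)
      \<comment> \<open>As \<open>x\<close> and \<open>y\<close> commute,
        \<open>x \<otimes> y\<close> generates a diagonal subgroup, the third vertex.\<close>
      have "x \<otimes> y \<notin> P x"
      proof
        assume "x \<otimes> y \<in> P x"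
        then have "inv x \<otimes> (x \<otimes> y) \<in> P x" using P(2)[OF x] by blast
        then show False using yx x y by (simp flip: m_assoc)
      qed
      moreover have "x \<otimes> y \<notin> P y"
      proof
        assume "x \<otimes> y \<in> P y"
        then have "(x \<otimes> y) \<otimes> inv y \<in> P y" using P(2)[OF y] by blast
        then show False using xy x y by (simp add: m_assoc)
      qed
      moreover have "(x \<otimes> y) [^] p = \<one>" using pow_mult_distrib[OF comm x y] xp yp by simp
      ultimately show False using three[of x y "x \<otimes> y" p p] x y p x1 yp yx by simp
    qed
  qed
  define PS where "PS = {r::nat. Factorial_Ring.prime r \<and> (\<exists>x\<in>carrier G. x \<noteq> \<one> \<and> x [^] r = \<one>)}"
  have diff: "y \<notin> P x" if "x \<in> carrier G" "y \<in> carrier G" "y \<noteq> \<one>" "x [^] p = \<one>" "y [^] q = \<one>"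
    "Factorial_Ring.prime p" "Factorial_Ring.prime q" "p \<noteq> q" for x y and p q :: nat
  proof
    assume "y \<in> P x"
    then obtain k :: int where "y = x [^] k" by (auto simp: P_def)
    then have "y [^] (int p) = (x [^] (int p)) [^] k" using that by (simp add: int_pow_pow mult.commute)
    then have "y [^] p = \<one>" using that by (simp add: int_pow_int)
    then have "ord y dvd p" "ord y dvd q" using that by (simp_all add: pow_eq_id)
    moreover have "coprime p q" using that primes_coprime by blast
    ultimately have "ord y = 1" by (metis coprime_common_divisor_nat)
    then show False using that ord_eq_1 by blast
  qed
  have "\<exists>(p::nat) q. Factorial_Ring.prime p \<and> Factorial_Ring.prime q \<and> PS \<subseteq> {p, q}"
  proof (cases "\<exists>p q. p \<in> PS \<and> q \<in> PS \<and> p \<noteq> q")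
    case True
    then obtain p q where pq: "p \<in> PS" "q \<in> PS" "p \<noteq> q" by blast
    then obtain x y where xy: "x \<in> carrier G" "x \<noteq> \<one>" "x [^] p = \<one>"
      "y \<in> carrier G" "y \<noteq> \<one>" "y [^] q = \<one>" by (auto simp: PS_def)
    have "r = p \<or> r = q" if "r \<in> PS" for r
    proof (rule ccontr)
      assume r: "\<not> (r = p \<or> r = q)"
      obtain z where "z \<in> carrier G" "z \<noteq> \<one>" "z [^] r = \<one>" using \<open>r \<in> PS\<close> by (auto simp: PS_def)
      moreover have "Factorial_Ring.prime p" "Factorial_Ring.prime q" "Factorial_Ring.prime r"
        using pq \<open>r \<in> PS\<close> by (auto simp: PS_def)
      ultimately show False using three[of x y z q r] diff xy pq(3) r by metis
    qed
    then show ?thesis using pq by (auto simp: PS_def)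
  next
    case False
    show ?thesis
    proof (cases "PS = {}")
      case True
      \<comment> \<open>In the trivial group any prime will do; 2 is taken.\<close>
      then show ?thesis using two_is_prime_nat by blast
    next
      case ne: False
      then obtain p where "p \<in> PS" by blast
      moreover have "PS \<subseteq> {p, p}" using False \<open>p \<in> PS\<close> by auto
      ultimately show ?thesis unfolding PS_def by blast
    qed
  qed
  then obtain p q where pq: "Factorial_Ring.prime p" "Factorial_Ring.prime q" "PS \<subseteq> {p, q}" by blast
  have "\<exists>i j. x [^] (p ^ i * q ^ j) = \<one>" if x: "x \<in> carrier G" for x
  proof -
    have nz: "ord x \<noteq> 0" using ord_ge_1[OF fin x] by simp
    have "r \<in> PS" if "Factorial_Ring.prime r" "r dvd ord x" for r
      using prime_order_element[OF x that nz] that x by (auto simp: PS_def)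
    then have "\<exists>i j. ord x = p ^ i * q ^ j"
      using pq(3) nz by (intro product_of_two_prime_powers) auto
    then show ?thesis using x by (metis pow_ord_eq_1)
  qed
  then show ?thesis using pq unique unfolding few_prime_subgroups_def by blast
qed

text \<open>Pigeonhole: each of the three subgroups contains an element of order \<open>p\<close> or
  \<open>q\<close>, so two of them share a prime and, by uniqueness, a nontrivial element.\<close>

lemma no_triangle_if_few_prime_subgroups:
  assumes p: "Factorial_Ring.prime p" and q: "Factorial_Ring.prime q" and few: "few_prime_subgroups G p q"
    and A: "subgroup A G" "A \<noteq> {\<one>}" and B: "subgroup B G" "B \<noteq> {\<one>}" and C: "subgroup C G" "C \<noteq> {\<one>}"
  shows "\<not> (A \<inter> B = {\<one>} \<and> A \<inter> C = {\<one>} \<and> B \<inter> C = {\<one>})"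
proof -
  define E where "E = (\<lambda>H r. \<exists>x\<in>H. x \<noteq> \<one> \<and> x [^] (r::nat) = \<one>)"
  have E: "E H p \<or> E H q" if H: "subgroup H G" "H \<noteq> {\<one>}" for H
  proof -
    interpret H: subgroup H G by (rule H)
    obtain x where x: "x \<in> H" "x \<noteq> \<one>" using H(2) H.one_closed by auto
    then have xc: "x \<in> carrier G" using H.mem_carrier by simp
    obtain i j where ij: "x [^] (p ^ i * q ^ j) = \<one>" using few xc unfolding few_prime_subgroups_def by blast
    then have dvd: "ord x dvd p ^ i * q ^ j" using xc by (simp add: pow_eq_id)
    have nz: "ord x \<noteq> 0" using dvd p q by (auto intro!: Nat.gr0I simp: prime_gt_0_nat)
    have "ord x \<noteq> 1" using x xc ord_eq_1 by simp
    then obtain r where r: "Factorial_Ring.prime r" "r dvd ord x" using prime_factor_nat by blast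
    then have "r dvd p ^ i * q ^ j" using dvd dvd_trans by blast
    then have "r = p \<or> r = q"
      using r(1) p q by (metis prime_dvd_mult_iff prime_dvd_power primes_dvd_imp_eq)
    moreover have "x [^] (ord x div r) \<in> H"
      using subgroup_int_pow_closed[OF H(1) x(1)] by (metis int_pow_int)
    then have "E H r" using prime_order_element[OF xc r nz] by (auto simp: E_def)
    ultimately show ?thesis by blast
  qed
  have meet: "H \<inter> K \<noteq> {\<one>}" if HK: "subgroup H G" "subgroup K G" "E H r" "E K r" "unique_prime_subgroup G r" for H K r
  proof -
    obtain x y where xy: "x \<in> H" "x \<noteq> \<one>" "x [^] r = \<one>" "y \<in> K" "y \<noteq> \<one>" "y [^] r = \<one>"
      using HK(3,4) by (auto simp: E_def)
    then obtain k :: int where "y = x [^] k"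
      using HK(5) subgroup.mem_carrier[OF HK(1)] subgroup.mem_carrier[OF HK(2)]
      unfolding unique_prime_subgroup_def by blast
    then have "y \<in> H" using subgroup_int_pow_closed[OF HK(1)] xy by simp
    then show ?thesis using xy by auto
  qed
  have u: "unique_prime_subgroup G p" "unique_prime_subgroup G q"
    using few by (auto simp: few_prime_subgroups_def)
  note m = meet[OF A(1) B(1)] meet[OF A(1) C(1)] meet[OF B(1) C(1)]
  show ?thesis using E[OF A] E[OF B] E[OF C] m[OF _ _ u(1)] m[OF _ _ u(2)] by blast
qed

end

section \<open>Nilpotent groups\<close>

context group
begin

lemma lower_central_series_subset: "lower_central_series G n \<subseteq> carrier G"
proof (induction n)
  case (Suc n)
  have "(\<Union>x \<in> lower_central_series G n. \<Union>y \<in> carrier G. {x \<otimes> y \<otimes> inv x \<otimes> inv y}) \<subseteq> carrier G"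
    using Suc by auto
  then show ?case by (simp add: generate_incl)
qed simp

lemma one_in_lower_central_series: "\<one> \<in> lower_central_series G n"
  by (cases n) (simp_all add: generate.one)

lemma lower_central_series_subgroup:
  assumes H: "subgroup H G"
  shows "lower_central_series (G\<lparr>carrier := H\<rparr>) n \<subseteq> lower_central_series G n"
proof (induction n)
  case 0
  then show ?case using subgroup.subset[OF H] by simp
next
  case (Suc n)
  interpret H: group "G\<lparr>carrier := H\<rparr>" using H by (rule subgroup.subgroup_is_group) (rule is_group)
  let ?L = "lower_central_series (G\<lparr>carrier := H\<rparr>) n"
  let ?K = "\<Union>x\<in>?L. \<Union>y\<in>H. {x \<otimes> y \<otimes> inv x \<otimes> inv y}"
  have L: "?L \<subseteq> H" using H.lower_central_series_subset by simp
  then have "?K \<subseteq> H"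
    using H by (auto intro!: subgroup.m_closed subgroup.m_inv_closed)
  moreover have "(\<Union>x\<in>?L. \<Union>y\<in>H. {x \<otimes> y \<otimes> inv\<^bsub>G\<lparr>carrier := H\<rparr>\<^esub> x \<otimes> inv\<^bsub>G\<lparr>carrier := H\<rparr>\<^esub> y}) = ?K"
    using L H by (intro SUP_cong refl) (auto simp: m_inv_consistent)
  ultimately have "lower_central_series (G\<lparr>carrier := H\<rparr>) (Suc n) = generate G ?K"
    using generate_consistent[OF _ H] by simp
  also have "\<dots> \<subseteq> lower_central_series G (Suc n)"
    using Suc subgroup.subset[OF H] unfolding lower_central_series.simps by (intro mono_generate) blast
  finally show ?case .
qed

lemma nilpotent_subgroup:
  assumes "nilpotent G" "subgroup H G"
  shows "nilpotent (G\<lparr>carrier := H\<rparr>)"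
proof -
  interpret H: group "G\<lparr>carrier := H\<rparr>" using assms(2) by (rule subgroup.subgroup_is_group) (rule is_group)
  obtain n where "lower_central_series G n = {\<one>}" using assms(1) by (auto simp: nilpotent_def)
  then have "lower_central_series (G\<lparr>carrier := H\<rparr>) n = {\<one>}"
    using lower_central_series_subgroup[OF assms(2), of n] H.one_in_lower_central_series[of n] by auto
  then show ?thesis unfolding nilpotent_def by auto
qed

text \<open>The last term of the lower central series that is not contained in \<open>H\<close> normalizes \<open>H\<close>.\<close>

lemma nilpotent_imp_normalizer_condition:
  assumes "nilpotent G"
  shows "normalizer_condition G"
  unfolding normalizer_condition_def
proof (intro allI impI)
  fix H assume H: "subgroup H G" "H \<noteq> carrier G"
  interpret H: subgroup H G by (rule H(1))
  obtain n where "lower_central_series G n = {\<one>}" using assms by (auto simp: nilpotent_def)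
  then have ex: "lower_central_series G n \<subseteq> H" using H.one_closed by simp
  define k where "k = (LEAST n. lower_central_series G n \<subseteq> H)"
  have k: "lower_central_series G k \<subseteq> H" unfolding k_def using ex by (rule LeastI)
  have "k \<noteq> 0" using k H H.subset by (intro notI) auto
  then obtain j where j: "k = Suc j" by (metis not0_implies_Suc)
  then have "\<not> lower_central_series G j \<subseteq> H"
    unfolding k_def using not_less_Least[of j "\<lambda>n. lower_central_series G n \<subseteq> H"] k_def by auto
  then obtain x where x: "x \<in> lower_central_series G j" "x \<notin> H" by blast
  then have xc: "x \<in> carrier G" using lower_central_series_subset by blast
  \<comment> \<open>The conjugate of \<open>h\<close> is a commutator, which lies in the next term
    of the series and hence in \<open>H\<close>, times \<open>h\<close>.\<close>
  have "x \<otimes> h \<otimes> inv x \<in> H" if h: "h \<in> H" for h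
  proof -
    have "x \<otimes> h \<otimes> inv x \<otimes> inv h \<in> lower_central_series G k"
      unfolding j lower_central_series.simps
      by (rule generate.incl, rule UN_I[OF x(1)], rule UN_I[OF H.mem_carrier[OF h]]) simp
    then have "x \<otimes> h \<otimes> inv x \<otimes> inv h \<otimes> h \<in> H" using k h by blast
    then show ?thesis using xc h by (simp add: m_assoc)
  qed
  \<comment> \<open>The normalizer condition has the inverse on the left, so the witness is
    \<open>inv x\<close>.\<close>
  moreover have "inv x \<notin> H" using x xc by (metis H.m_inv_closed inv_inv)
  ultimately show "\<exists>g\<in>carrier G - H. \<forall>h\<in>H. inv g \<otimes> h \<otimes> g \<in> H"
    using xc by (intro bexI[of _ "inv x"]) auto
qed

section \<open>The \<open>p\<close>-parts of a finite group with growing normalizers\<close>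

lemma finite_subgroupI:
  assumes fin: "finite (carrier G)" and S: "S \<subseteq> carrier G" "S \<noteq> {}"
    and closed: "\<And>x y. x \<in> S \<Longrightarrow> y \<in> S \<Longrightarrow> x \<otimes> y \<in> S"
  shows "subgroup S G"
proof (rule subgroupI[OF S _ closed])
  fix x assume x: "x \<in> S"
  have pow: "x [^] Suc n \<in> S" for n
    by (induction n) (use x S closed in \<open>auto simp: subsetD\<close>)
  have xc: "x \<in> carrier G" using x S by blast
  have "ord x \<ge> 1" using ord_ge_1[OF fin xc] .
  \<comment> \<open>The exponent \<open>2 * ord x - 1\<close> is positive even if
    \<open>ord x = 1\<close>, and \<open>pow\<close> covers positive exponents only.\<close>
  have "x [^] (ord x + (ord x - 1)) \<otimes> x = x [^] (ord x + ord x)"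
    using \<open>ord x \<ge> 1\<close> by (simp flip: nat_pow_Suc)
  also have "\<dots> = \<one>" using xc by (simp add: pow_eq_id)
  finally have "inv x = x [^] (ord x + (ord x - 1))" using xc by (intro inv_equality) simp_all
  also have "ord x + (ord x - 1) = Suc (ord x + ord x - 2)" using \<open>ord x \<ge> 1\<close> by simp
  finally show "inv x \<in> S" using pow by simp
qed

text \<open>For prime \<open>p\<close> this turns out to be the Sylow subgroup of a finite nilpotent
  group. Defined through orders it is visibly closed under conjugation, and closure under products
  is what has to be shown.\<close>

definition p_elements :: "nat \<Rightarrow> 'a set" where
  "p_elements p = {x \<in> carrier G. \<exists>i. x [^] (p ^ i) = \<one>}"

lemma p_elements_conj:
  assumes "x \<in> p_elements p" "g \<in> carrier G"
  shows "inv g \<otimes> x \<otimes> g \<in> p_elements p"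
proof -
  obtain i where x: "x \<in> carrier G" "x [^] (p ^ i) = \<one>" using assms(1) by (auto simp: p_elements_def)
  then have "(inv g \<otimes> x \<otimes> g) [^] (int (p ^ i)) = \<one>"
    unfolding conj_int_pow[OF assms(2) x(1)] unfolding int_pow_int using assms(2) by simp
  then show ?thesis using x assms(2) unfolding int_pow_int by (auto simp: p_elements_def)
qed

text \<open>\<open>S\<close> consists of the products of powers of \<open>x\<close> with elements of
  \<open>P\<close>. Modulo \<open>P\<close> an element of \<open>S\<close> is a power of
  \<open>x\<close>, so some iterated \<open>p\<close>-th power of it falls into \<open>P\<close>.
  Natural exponents suffice because a finite set closed under products is a subgroup.\<close>

lemma p_subgroup_extend:
  assumes fin: "finite (carrier G)" and P: "subgroup P G" "P \<subseteq> p_elements p"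
    and x: "x \<in> p_elements p" and norm: "\<And>h. h \<in> P \<Longrightarrow> inv x \<otimes> h \<otimes> x \<in> P"
  shows "\<exists>S. subgroup S G \<and> S \<subseteq> p_elements p \<and> insert x P \<subseteq> S"
proof -
  interpret P: subgroup P G by (rule P(1))
  have xc[simp]: "x \<in> carrier G" using x by (simp add: p_elements_def)
  have swap: "\<exists>v\<in>P. u \<otimes> x [^] (n::nat) = x [^] n \<otimes> v" if "u \<in> P" for u n
  proof (induction n)
    case 0
    then show ?case using that by auto
  next
    case (Suc n)
    then obtain v where v: "v \<in> P" "u \<otimes> x [^] n = x [^] n \<otimes> v" by blast
    have "u \<otimes> x [^] Suc n = x [^] n \<otimes> v \<otimes> x" using that v by (simp flip: m_assoc)
    also have "\<dots> = x [^] n \<otimes> (x \<otimes> inv x) \<otimes> v \<otimes> x" using v by simp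
    also have "\<dots> = x [^] Suc n \<otimes> (inv x \<otimes> v \<otimes> x)"
      using v(1) by (simp only: m_assoc nat_pow_Suc nat_pow_closed xc inv_closed m_closed P.mem_carrier)
    finally show ?case using norm[OF v(1)] by blast
  qed
  define S where "S = {x [^] (n::nat) \<otimes> u | n u. u \<in> P}"
  have mult: "\<exists>w\<in>P. (x [^] (n::nat) \<otimes> u) \<otimes> (x [^] (k::nat) \<otimes> v) = x [^] (n + k) \<otimes> w"
    if uv: "u \<in> P" "v \<in> P" for u v n k
  proof -
    obtain u' where u': "u' \<in> P" "u \<otimes> x [^] k = x [^] k \<otimes> u'" using swap uv by blast
    have "(x [^] n \<otimes> u) \<otimes> (x [^] k \<otimes> v) = x [^] n \<otimes> (u \<otimes> x [^] k) \<otimes> v"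
      using uv by (simp add: m_assoc)
    also have "\<dots> = x [^] (n + k) \<otimes> (u' \<otimes> v)"
      unfolding u'(2) using uv u'(1) by (simp add: m_assoc flip: nat_pow_mult)
    finally show ?thesis using u' uv by blast
  qed
  have "subgroup S G"
  proof (rule finite_subgroupI[OF fin])
    show "S \<subseteq> carrier G" by (auto simp: S_def)
    show "S \<noteq> {}" unfolding S_def using P.one_closed by blast
    show "y \<otimes> z \<in> S" if "y \<in> S" "z \<in> S" for y z
      using that mult unfolding S_def by blast
  qed
  moreover have "S \<subseteq> p_elements p"
  proof
    fix y assume "y \<in> S"
    then obtain n u where y: "y = x [^] (n::nat) \<otimes> u" "u \<in> P" by (auto simp: S_def)
    then have yc: "y \<in> carrier G" by simp
    have pow: "\<exists>v\<in>P. y [^] (k::nat) = x [^] (n * k) \<otimes> v" for k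
    proof (induction k)
      case 0
      then show ?case using P.one_closed by (intro bexI[of _ \<one>]) auto
    next
      case (Suc k)
      then obtain v where "v \<in> P" "y [^] k = x [^] (n * k) \<otimes> v" by blast
      then show ?case using mult[OF \<open>v \<in> P\<close> y(2), of "n * k" n] by (simp add: y(1) add.commute)
    qed
    obtain i where i: "x [^] (p ^ i) = \<one>" using x by (auto simp: p_elements_def)
    obtain v where v: "v \<in> P" "y [^] (p ^ i) = x [^] (n * p ^ i) \<otimes> v" using pow by blast
    have "x [^] (n * p ^ i) = \<one>" using i by (metis mult.commute nat_pow_one nat_pow_pow xc)
    then have "y [^] (p ^ i) \<in> P" using v by simp
    then obtain j where "(y [^] (p ^ i)) [^] (p ^ j) = \<one>" using P(2) by (auto simp: p_elements_def)
    then have "y [^] (p ^ (i + j)) = \<one>" using yc by (simp add: nat_pow_pow power_add)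
    then show "y \<in> p_elements p" using yc unfolding p_elements_def by blast
  qed
  moreover have "x \<in> S"
  proof -
    have "x = x [^] (1::nat) \<otimes> \<one>" by simp
    then show ?thesis using P.one_closed unfolding S_def by blast
  qed
  moreover have "P \<subseteq> S"
  proof
    fix u assume "u \<in> P"
    then have "u = x [^] (0::nat) \<otimes> u" by simp
    then show "u \<in> S" using \<open>u \<in> P\<close> unfolding S_def by blast
  qed
  ultimately show ?thesis by blast
qed

text \<open>Let \<open>P\<close> be a maximal subgroup consisting of \<open>p\<close>-elements and
  \<open>N\<close> its normalizer. By maximality all \<open>p\<close>-elements of \<open>N\<close>
  lie in \<open>P\<close>, so whatever normalizes \<open>N\<close> also normalizes \<open>P\<close>.
  Growth of normalizers then gives \<open>N = carrier G\<close>, and \<open>P\<close> contains all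
  \<open>p\<close>-elements.\<close>

lemma p_elements_normal:
  assumes fin: "finite (carrier G)" and nc: "normalizer_condition G"
  shows "p_elements p \<lhd> G"
proof -
  define Ps where "Ps = {P. subgroup P G \<and> P \<subseteq> p_elements p}"
  have "Ps \<subseteq> Pow (carrier G)" unfolding Ps_def using subgroup.subset by blast
  then have "finite Ps" using fin by (meson finite_Pow_iff finite_subset)
  moreover have "{\<one>} \<in> Ps" by (auto simp: Ps_def p_elements_def intro: triv_subgroup)
  ultimately obtain P where P: "P \<in> Ps" and max: "\<And>Q. Q \<in> Ps \<Longrightarrow> P \<subseteq> Q \<Longrightarrow> P = Q"
    using finite_has_maximal2[of Ps "{\<one>}"] by blast
  then have Psub: "subgroup P G" and Pp: "P \<subseteq> p_elements p" by (auto simp: Ps_def)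
  interpret P: subgroup P G by (rule Psub)
  have in_P: "x \<in> P" if "x \<in> p_elements p" "\<And>h. h \<in> P \<Longrightarrow> inv x \<otimes> h \<otimes> x \<in> P" for x
    using p_subgroup_extend[OF fin Psub Pp that] max unfolding Ps_def by blast
  define N where "N = {g \<in> carrier G. \<forall>h\<in>P. inv g \<otimes> h \<otimes> g \<in> P}"
  have PN: "P \<subseteq> N" by (auto simp: N_def)
  have "subgroup N G"
  proof (rule finite_subgroupI[OF fin])
    show "N \<noteq> {}" using PN P.one_closed by blast
    fix x y assume xy: "x \<in> N" "y \<in> N"
    have "inv (x \<otimes> y) \<otimes> h \<otimes> (x \<otimes> y) = inv y \<otimes> (inv x \<otimes> h \<otimes> x) \<otimes> y" if "h \<in> P" for h
      using xy that by (simp add: N_def inv_mult_group m_assoc)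
    then show "x \<otimes> y \<in> N" using xy by (auto simp: N_def)
  qed (auto simp: N_def)
  have "N = carrier G"
  proof (rule ccontr)
    assume "N \<noteq> carrier G"
    then obtain g where g: "g \<in> carrier G" "g \<notin> N" "\<And>h. h \<in> N \<Longrightarrow> inv g \<otimes> h \<otimes> g \<in> N"
      using nc \<open>subgroup N G\<close> unfolding normalizer_condition_def by blast
    have "inv g \<otimes> h \<otimes> g \<in> P" if "h \<in> P" for h
    proof (rule in_P)
      show "inv g \<otimes> h \<otimes> g \<in> p_elements p" using p_elements_conj g(1) that Pp by blast
      have "inv g \<otimes> h \<otimes> g \<in> N" using g(3) that PN by blast
      then show "inv (inv g \<otimes> h \<otimes> g) \<otimes> u \<otimes> (inv g \<otimes> h \<otimes> g) \<in> P" if "u \<in> P" for u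
        using that by (simp add: N_def)
    qed
    then show False using g by (simp add: N_def)
  qed
  have "p_elements p \<subseteq> P"
  proof
    fix x assume x: "x \<in> p_elements p"
    then have "x \<in> N" using \<open>N = carrier G\<close> by (simp add: p_elements_def)
    then show "x \<in> P" using in_P[OF x] by (simp add: N_def)
  qed
  then have eq: "P = p_elements p" using Pp by blast
  have "x \<otimes> h \<otimes> inv x \<in> P" if "x \<in> carrier G" "h \<in> P" for x h
    using p_elements_conj[of h p "inv x"] that eq by simp
  then show ?thesis unfolding normal_inv_iff using Psub eq by simp
qed

text \<open>A Bezout identity for \<open>p ^ i\<close> and \<open>q ^ j\<close> splits
  \<open>x\<close> into a \<open>p\<close>-part and a \<open>q\<close>-part, both powers of
  \<open>x\<close>; coprime orders make the intersection trivial.\<close>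

lemma iso_p_elements_product:
  assumes fin: "finite (carrier G)" and nc: "normalizer_condition G"
    and pq: "coprime p q"
    and pq_group: "\<And>x. x \<in> carrier G \<Longrightarrow> \<exists>i j. x [^] (p ^ i * q ^ j) = \<one>"
  shows "G\<lparr>carrier := p_elements p\<rparr> \<times>\<times> G\<lparr>carrier := p_elements q\<rparr> \<cong> G"
proof -
  \<comment> \<open>Needed because \<open>iso_group_mul_gen\<close> speaks of
    \<open>subgroup_generated\<close>.\<close>
  have sub: "subgroup_generated G (p_elements r) = G\<lparr>carrier := p_elements r\<rparr>" for r
  proof -
    have "subgroup (p_elements r) G" using p_elements_normal[OF fin nc] normal_imp_subgroup by blast
    then have "carrier (subgroup_generated G (p_elements r)) = p_elements r"
      by (rule subgroup.carrier_subgroup_generated_subgroup)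
    then show ?thesis by (simp add: subgroup_generated_def)
  qed
  have "p_elements p \<inter> p_elements q \<subseteq> {\<one>}"
  proof
    fix x assume x: "x \<in> p_elements p \<inter> p_elements q"
    then have xc: "x \<in> carrier G" by (simp add: p_elements_def)
    obtain i j where "ord x dvd p ^ i" "ord x dvd q ^ j"
      using x xc by (auto simp: p_elements_def pow_eq_id)
    moreover have "coprime (p ^ i) (q ^ j)" using pq by simp
    ultimately have "ord x = 1" by (metis coprime_common_divisor_nat)
    then show "x \<in> {\<one>}" using ord_eq_1 xc by simp
  qed
  moreover have "carrier G \<subseteq> p_elements p <#> p_elements q"
  proof
    fix x assume x: "x \<in> carrier G"
    then obtain i j where ij: "x [^] (p ^ i * q ^ j) = \<one>" using pq_group by blast
    have "coprime (int (q ^ j)) (int (p ^ i))" using pq by (simp add: coprime_commute)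
    then obtain u where "int (p ^ i) dvd - 1 + u * int (q ^ j)" using coprime_solve_dvd by blast
    then obtain k where "- 1 + u * int (q ^ j) = int (p ^ i) * k" by blast
    then have "int (q ^ j) * u + int (p ^ i) * (- k) = 1" by (simp add: algebra_simps)
    then obtain v where uv: "int (q ^ j) * u + int (p ^ i) * v = 1" by blast
    have one: "x [^] (int (p ^ i) * int (q ^ j) * k) = \<one>" for k
    proof -
      have "x [^] (int (p ^ i * q ^ j)) = \<one>" using ij unfolding int_pow_int .
      then show ?thesis using x by (metis int_pow_one int_pow_pow of_nat_mult)
    qed
    have "(x [^] (int (q ^ j) * u)) [^] (int (p ^ i)) = \<one>" "(x [^] (int (p ^ i) * v)) [^] (int (q ^ j)) = \<one>"
      using x one[of u] one[of v] by (simp_all add: int_pow_pow ac_simps)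
    then have "x [^] (int (q ^ j) * u) \<in> p_elements p" "x [^] (int (p ^ i) * v) \<in> p_elements q"
      using x unfolding int_pow_int p_elements_def by auto
    moreover have "x = x [^] (int (q ^ j) * u) \<otimes> x [^] (int (p ^ i) * v)"
      using x uv by (simp flip: int_pow_mult)
    ultimately show "x \<in> p_elements p <#> p_elements q" unfolding set_mult_def by blast
  qed
  moreover have "p_elements p <#> p_elements q \<subseteq> carrier G"
    by (auto simp: set_mult_def p_elements_def)
  ultimately show ?thesis
    using iso_group_mul_gen[OF p_elements_normal[OF fin nc] p_elements_normal[OF fin nc], of p q]
    unfolding sub by (auto intro: is_isoI)
qed

end

section \<open>Groups with few subgroups of prime order\<close>

lemma nat_pow_DirProd: "(x, y) [^]\<^bsub>G \<times>\<times> H\<^esub> (n::nat) = (x [^]\<^bsub>G\<^esub> n, y [^]\<^bsub>H\<^esub> n)"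
  by (induction n) simp_all

lemma int_pow_DirProd:
  assumes "group G" "group H" "x \<in> carrier G" "y \<in> carrier H"
  shows "(x, y) [^]\<^bsub>G \<times>\<times> H\<^esub> (k::int) = (x [^]\<^bsub>G\<^esub> k, y [^]\<^bsub>H\<^esub> k)"
proof -
  interpret G: group G by fact
  interpret H: group H by fact
  interpret GH: group "G \<times>\<times> H" by (rule DirProd_group) fact+
  show ?thesis
  proof (cases k rule: int_cases2)
    case (nonneg n)
    then show ?thesis by (simp only: int_pow_int nat_pow_DirProd)
  next
    case (nonpos n)
    have "(x, y) \<in> carrier (G \<times>\<times> H)" using assms by simp
    then show ?thesis
      unfolding nonpos GH.int_pow_neg_int G.int_pow_neg_int[OF assms(3)] H.int_pow_neg_int[OF assms(4)]
      by (simp only: nat_pow_DirProd GH.int_pow_neg_int) (simp add: assms)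
  qed
qed

lemma (in group) coprime_order_torsion_free:
  assumes "x \<in> carrier G" "x [^] (r::nat) = \<one>" "coprime r (order G)"
  shows "x = \<one>"
proof -
  have "ord x dvd r" "ord x dvd order G"
    using assms ord_dvd_group_order by (simp_all add: pow_eq_id)
  then have "ord x = 1" using assms(3) by (metis coprime_common_divisor_nat)
  then show ?thesis using assms(1) ord_eq_1 by simp
qed

lemma (in group) few_prime_subgroupsI:
  assumes "unique_prime_subgroup G p" "unique_prime_subgroup G q" "order G = p ^ i * q ^ j"
  shows "few_prime_subgroups G p q"
proof -
  have "x [^] (p ^ i * q ^ j) = \<one>" if "x \<in> carrier G" for x
    using pow_order_eq_1[OF that] unfolding assms(3) .
  then show ?thesis using assms(1,2) unfolding few_prime_subgroups_def by blast
qed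

lemma unique_prime_subgroup_iso:
  assumes "group G" "group H" "G \<cong> H" "unique_prime_subgroup H p"
  shows "unique_prime_subgroup G p"
proof -
  interpret G: group G by fact
  interpret H: group H by fact
  obtain h where h: "h \<in> iso G H" using assms(3) by (auto simp: is_iso_def)
  then interpret h: group_hom G H h
    by unfold_locales (simp add: iso_def)
  have inj: "inj_on h (carrier G)" using h by (simp add: iso_def bij_betw_def)
  show ?thesis
    unfolding unique_prime_subgroup_def
  proof (intro ballI impI)
    fix x y assume xy: "x \<in> carrier G" "y \<in> carrier G" "x \<noteq> \<one>\<^bsub>G\<^esub>" "x [^]\<^bsub>G\<^esub> p = \<one>\<^bsub>G\<^esub>" "y [^]\<^bsub>G\<^esub> p = \<one>\<^bsub>G\<^esub>"
    have "h x \<noteq> \<one>\<^bsub>H\<^esub>" using inj_onD[OF inj, of x "\<one>\<^bsub>G\<^esub>"] xy by auto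
    moreover have "h x [^]\<^bsub>H\<^esub> p = \<one>\<^bsub>H\<^esub>" "h y [^]\<^bsub>H\<^esub> p = \<one>\<^bsub>H\<^esub>"
      using h.hom_nat_pow[of x p] h.hom_nat_pow[of y p] xy by simp_all
    ultimately obtain k :: int where "h y = h x [^]\<^bsub>H\<^esub> k"
      using assms(4) xy h.hom_closed unfolding unique_prime_subgroup_def by blast
    then have "h y = h (x [^]\<^bsub>G\<^esub> k)" using h.hom_int_pow xy by simp
    then have "y = x [^]\<^bsub>G\<^esub> k" using inj_onD[OF inj] xy by simp
    then show "\<exists>k::int. y = x [^]\<^bsub>G\<^esub> k" by blast
  qed
qed

lemma (in group) unique_prime_subgroup_subgroup:
  assumes "subgroup H G" "unique_prime_subgroup G p"
  shows "unique_prime_subgroup (G\<lparr>carrier := H\<rparr>) p"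
  unfolding unique_prime_subgroup_def
proof (intro ballI impI)
  fix x y assume xy: "x \<in> carrier (G\<lparr>carrier := H\<rparr>)" "y \<in> carrier (G\<lparr>carrier := H\<rparr>)"
    "x \<noteq> \<one>\<^bsub>G\<lparr>carrier := H\<rparr>\<^esub>" "x [^]\<^bsub>G\<lparr>carrier := H\<rparr>\<^esub> p = \<one>\<^bsub>G\<lparr>carrier := H\<rparr>\<^esub>"
    "y [^]\<^bsub>G\<lparr>carrier := H\<rparr>\<^esub> p = \<one>\<^bsub>G\<lparr>carrier := H\<rparr>\<^esub>"
  then have H: "x \<in> H" "y \<in> H" by simp_all
  then have "x \<in> carrier G" "y \<in> carrier G" using subgroup.mem_carrier[OF assms(1)] by blast+
  moreover have "x \<noteq> \<one>" "x [^] p = \<one>" "y [^] p = \<one>"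
    using xy(3-5) unfolding nat_pow_consistent[of _ p H, symmetric] by simp_all
  ultimately obtain k :: int where "y = x [^] k"
    using assms(2) unfolding unique_prime_subgroup_def by blast
  then have "y = x [^]\<^bsub>G\<lparr>carrier := H\<rparr>\<^esub> k" unfolding int_pow_consistent[OF assms(1) H(1)] .
  then show "\<exists>k::int. y = x [^]\<^bsub>G\<lparr>carrier := H\<rparr>\<^esub> k" by blast
qed

text \<open>As \<open>p\<close> is coprime to the order of \<open>H\<close>, elements with trivial
  \<open>p\<close>-th power have trivial second coordinate.\<close>

lemma unique_prime_subgroup_DirProd_left:
  assumes "group G" "group H" "unique_prime_subgroup G p" "coprime p (order H)"
  shows "unique_prime_subgroup (G \<times>\<times> H) p"
proof -
  interpret G: group G by fact
  interpret H: group H by fact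
  show ?thesis
    unfolding unique_prime_subgroup_def
  proof (intro ballI impI)
    fix v w assume v: "v \<in> carrier (G \<times>\<times> H)" and w: "w \<in> carrier (G \<times>\<times> H)" and "v \<noteq> \<one>\<^bsub>G \<times>\<times> H\<^esub>"
      "v [^]\<^bsub>G \<times>\<times> H\<^esub> p = \<one>\<^bsub>G \<times>\<times> H\<^esub>" "w [^]\<^bsub>G \<times>\<times> H\<^esub> p = \<one>\<^bsub>G \<times>\<times> H\<^esub>"
    moreover obtain x y x' y' where vw: "v = (x, y)" "w = (x', y')" by (metis surj_pair)
    ultimately have xy: "x [^]\<^bsub>G\<^esub> p = \<one>\<^bsub>G\<^esub>" "y [^]\<^bsub>H\<^esub> p = \<one>\<^bsub>H\<^esub>" "x' [^]\<^bsub>G\<^esub> p = \<one>\<^bsub>G\<^esub>" "y' [^]\<^bsub>H\<^esub> p = \<one>\<^bsub>H\<^esub>"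
      "x \<in> carrier G" "x' \<in> carrier G" "y \<in> carrier H" "y' \<in> carrier H" "(x, y) \<noteq> (\<one>\<^bsub>G\<^esub>, \<one>\<^bsub>H\<^esub>)"
      by (auto simp: nat_pow_DirProd)
    then have y: "y = \<one>\<^bsub>H\<^esub>" "y' = \<one>\<^bsub>H\<^esub>"
      using H.coprime_order_torsion_free assms(4) by blast+
    then obtain k :: int where "x' = x [^]\<^bsub>G\<^esub> k"
      using assms(3) xy unfolding unique_prime_subgroup_def by blast
    then have "w = v [^]\<^bsub>G \<times>\<times> H\<^esub> k"
      using xy y vw by (simp add: int_pow_DirProd[OF assms(1,2)])
    then show "\<exists>k::int. w = v [^]\<^bsub>G \<times>\<times> H\<^esub> k" by blast
  qed
qed

lemma DirProd_swap_iso: "G \<times>\<times> H \<cong> H \<times>\<times> G"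
  using DirProd_commute_iso_set[of G H] by (rule is_isoI)

lemma unique_prime_subgroup_DirProd_right:
  assumes "group G" "group H" "unique_prime_subgroup H p" "coprime p (order G)"
  shows "unique_prime_subgroup (G \<times>\<times> H) p"
  using unique_prime_subgroup_iso[OF DirProd_group[OF assms(1,2)] DirProd_group[OF assms(2,1)] DirProd_swap_iso]
    unique_prime_subgroup_DirProd_left[OF assms(2,1,3,4)] .

section \<open>Cyclic and generalized quaternion groups\<close>

lemma (in group) unique_prime_subgroup_cyclic:
  assumes fin: "finite (carrier G)" and cyc: "cyclic_group G" and p: "Factorial_Ring.prime p"
  shows "unique_prime_subgroup G p"
  unfolding unique_prime_subgroup_def
proof (intro ballI impI)
  fix x y assume xy: "x \<in> carrier G" "y \<in> carrier G" "x \<noteq> \<one>" "x [^] p = \<one>" "y [^] p = \<one>"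
  obtain a where a: "a \<in> carrier G" and gen: "carrier G = range (\<lambda>n::int. a [^] n)"
    using cyc unfolding cyclic_group by blast
  obtain i j :: int where x: "x = a [^] i" and y: "y = a [^] j" using xy gen by blast
  have "ord a \<noteq> 0" using ord_ge_1[OF fin a] by simp
  have "a [^] (i * int p) = \<one>" "a [^] (j * int p) = \<one>"
    using xy(4,5) a by (simp_all add: x y int_pow_int flip: int_pow_pow)
  then have dvd: "int (ord a) dvd int p * i" "int (ord a) dvd int p * j"
    by (simp_all add: int_pow_eq_id[OF a] mult.commute)
  have not_dvd: "\<not> int (ord a) dvd i" using xy(3) by (simp add: x int_pow_eq_id[OF a])
  \<comment> \<open>This holds because \<open>x\<close> is nontrivial. With
    \<open>ord a = p * c\<close> both \<open>x\<close> and \<open>y\<close> are powers of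
    \<open>a [^] c\<close>, and it remains to solve \<open>t * i' = j'\<close> modulo
    \<open>p\<close>.\<close>
  have "p dvd ord a"
  proof (rule ccontr)
    assume "\<not> p dvd ord a"
    then have "coprime (int (ord a)) (int p)" using p prime_imp_coprime coprime_commute by (metis coprime_int_iff)
    then show False using dvd(1) not_dvd by (simp add: coprime_dvd_mult_right_iff)
  qed
  then obtain c where c: "ord a = p * c" by blast
  have p0: "p > 0" using p prime_gt_0_nat by blast
  have "int c dvd i" "int c dvd j" using dvd p0 by (simp_all add: c)
  then obtain i' j' where ij: "i = int c * i'" "j = int c * j'" unfolding dvd_def by blast
  have "\<not> int p dvd i'" using not_dvd by (auto simp: c ij)
  then have "coprime i' (int p)"
    using p by (metis coprime_commute prime_imp_coprime prime_nat_int_transfer)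
  then obtain t where "int p dvd - j' + t * i'" using coprime_solve_dvd by blast
  then have "int c * int p dvd int c * (- j' + t * i')" by (rule mult_dvd_mono[OF dvd_refl])
  then have "int (ord a) dvd i * t - j" by (simp add: c ij algebra_simps)
  then have "y = x [^] t" unfolding x y using a by (simp add: int_pow_pow int_pow_eq)
  then show "\<exists>k::int. y = x [^] k" by blast
qed

text \<open>Every element outside the cyclic part squares to \<open>(M, False)\<close>, which is not
  the identity, so \<open>(M, False)\<close> is the only involution.\<close>

lemma unique_prime_subgroup_generalized_quaternion:
  assumes "n \<ge> 2"
  shows "unique_prime_subgroup (generalized_quaternion n) 2"
proof -
  define M :: int where "M = 2 ^ (n - 2)"
  define Q where "Q = generalized_quaternion n"
  have "n - 1 = Suc (n - 2)" using assms by simp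
  then have N: "(2::int) ^ (n - 1) = 2 * M" unfolding M_def by (simp only: power_Suc)
  have pos: "M > 0" by (simp add: M_def)
  interpret Q: group Q unfolding Q_def by (rule group_generalized_quaternion) fact
  have carr: "carrier Q = {0..<2 * M} \<times> UNIV" and one: "\<one>\<^bsub>Q\<^esub> = (0, False)"
    and mult: "\<And>i s j t. (i, s) \<otimes>\<^bsub>Q\<^esub> (j, t) =
        ((i + (if s then - j else j) + (if s \<and> t then M else 0)) mod (2 * M), s \<noteq> t)"
    unfolding Q_def generalized_quaternion_def N M_def[symmetric] by simp_all
  have involution: "x = \<one>\<^bsub>Q\<^esub> \<or> x = (M, False)" if x: "x \<in> carrier Q" "x [^]\<^bsub>Q\<^esub> (2::nat) = \<one>\<^bsub>Q\<^esub>" for x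
  proof -
    obtain i s where xis: "x = (i, s)" "0 \<le> i" "i < 2 * M" using x(1) by (auto simp: carr)
    have "x \<otimes>\<^bsub>Q\<^esub> x = \<one>\<^bsub>Q\<^esub>" using x by (simp add: numeral_2_eq_2)
    then have *: "(i + (if s then - i else i) + (if s then M else 0)) mod (2 * M) = 0"
      by (simp add: xis mult one)
    then have "\<not> s" using pos by auto
    then have "2 * M dvd 2 * i" using * by (simp add: dvd_eq_mod_eq_0)
    then obtain k where k: "i = M * k" by auto
    then have "0 \<le> k" "k < 2" using xis pos by (auto simp: zero_le_mult_iff mult.commute)
    then have "k = 0 \<or> k = 1" by auto
    then show ?thesis using k xis \<open>\<not> s\<close> one by auto
  qed
  have "\<exists>k::int. y = x [^]\<^bsub>Q\<^esub> k"
    if "x \<in> carrier Q" "y \<in> carrier Q" "x \<noteq> \<one>\<^bsub>Q\<^esub>" "x [^]\<^bsub>Q\<^esub> (2::nat) = \<one>\<^bsub>Q\<^esub>" "y [^]\<^bsub>Q\<^esub> (2::nat) = \<one>\<^bsub>Q\<^esub>" for x y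
  proof -
    have "y = \<one>\<^bsub>Q\<^esub> \<or> y = x" using involution[of x] involution[of y] that by auto
    then show ?thesis using that(1) by (metis Q.int_pow_1 int_pow_0)
  qed
  then show ?thesis unfolding unique_prime_subgroup_def Q_def by blast
qed

lemma order_integer_mod_group: "n > 0 \<Longrightarrow> order (integer_mod_group n) = n"
  by (simp add: order_def carrier_integer_mod_group)

lemma cyclic_integer_mod_group: "cyclic_group (integer_mod_group n)"
proof -
  interpret group "integer_mod_group n" by simp
  \<comment> \<open>The reduction matters for \<open>n = 1\<close>, where the generator is
    0.\<close>
  have "1 mod int n \<in> carrier (integer_mod_group n)" by (simp add: carrier_integer_mod_group)
  moreover have "carrier (integer_mod_group n) = range (\<lambda>k::int. (1 mod int n) [^]\<^bsub>integer_mod_group n\<^esub> k)"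
    by (auto simp: carrier_integer_mod_group int_pow_integer_mod_group mod_mult_right_eq image_iff)
      (metis mod_pos_pos_trivial)
  ultimately show ?thesis unfolding cyclic_group by blast
qed

lemma (in group) cyclic_iso_integer_mod_group:
  assumes fin: "finite (carrier G)" and cyc: "cyclic_group G"
  shows "G \<cong> integer_mod_group (order G)"
proof -
  obtain a where a[simp]: "a \<in> carrier G" and gen: "carrier G = range (\<lambda>n::int. a [^] n)"
    using cyc unfolding cyclic_group by blast
  have ord: "ord a = order G"
    using cyclic_order_is_ord[OF a] carrier_subgroup_generated_by_singleton[OF a] gen by (simp add: order_def)
  have n0: "order G > 0" using fin order_gt_0_iff_finite by blast
  have a_eq: "a [^] i = a [^] j \<longleftrightarrow> i mod int (order G) = j mod int (order G)" for i j :: int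
    using int_pow_eq[OF a, of i j] ord by (metis mod_eq_dvd_iff)
  let ?Z = "integer_mod_group (order G)" and ?h = "\<lambda>k::int. a [^] k"
  have carr: "carrier ?Z = {0..<int (order G)}" using n0 by (simp add: carrier_integer_mod_group)
  have "?h \<in> hom ?Z G"
  proof (rule homI)
    fix i j
    have "a [^] ((i + j) mod int (order G)) = a [^] (i + j)" unfolding a_eq by simp
    then show "a [^] (i \<otimes>\<^bsub>?Z\<^esub> j) = a [^] i \<otimes> a [^] j" by (simp add: int_pow_mult)
  qed simp
  moreover have "inj_on ?h (carrier ?Z)"
    unfolding inj_on_def a_eq carr by auto
  moreover have "?h ` carrier ?Z = carrier G"
  proof
    show "carrier G \<subseteq> ?h ` carrier ?Z"
    proof
      fix x assume "x \<in> carrier G"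
      then obtain k :: int where "x = a [^] k" using gen by blast
      then have "x = a [^] (k mod int (order G))" using a_eq by simp
      then show "x \<in> ?h ` carrier ?Z" using n0 by (auto simp: carr)
    qed
  qed auto
  ultimately have "?h \<in> iso ?Z G" by (simp add: iso_iff hom_def)
  then have "?Z \<cong> G" by (rule is_isoI)
  then show ?thesis by (rule group.iso_sym[OF group_integer_mod_group])
qed

text \<open>The Chinese remainder theorem merges the exponents of the two coordinates into
  one.\<close>

lemma cyclic_group_DirProd:
  assumes "group G" "group H" "cyclic_group G" "cyclic_group H" "coprime (order G) (order H)"
  shows "cyclic_group (G \<times>\<times> H)"
proof -
  interpret G: group G by fact
  interpret H: group H by fact
  interpret GH: group "G \<times>\<times> H" by (rule DirProd_group) fact+
  obtain a where a: "a \<in> carrier G" and genG: "carrier G = range (\<lambda>n::int. a [^]\<^bsub>G\<^esub> n)"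
    using assms(3) unfolding G.cyclic_group by blast
  obtain b where b: "b \<in> carrier H" and genH: "carrier H = range (\<lambda>n::int. b [^]\<^bsub>H\<^esub> n)"
    using assms(4) unfolding H.cyclic_group by blast
  have "carrier (G \<times>\<times> H) \<subseteq> range (\<lambda>n::int. (a, b) [^]\<^bsub>G \<times>\<times> H\<^esub> n)"
  proof
    fix v assume "v \<in> carrier (G \<times>\<times> H)"
    then obtain i j :: int where v: "v = (a [^]\<^bsub>G\<^esub> i, b [^]\<^bsub>H\<^esub> j)"
      unfolding DirProd_def using genG genH by auto
    have "coprime (int (G.ord a)) (int (H.ord b))"
      using assms(5) G.ord_dvd_group_order[OF a] H.ord_dvd_group_order[OF b]
      by (metis coprime_divisors coprime_int_iff)
    then obtain n where "[n = i] (mod int (G.ord a))" "[n = j] (mod int (H.ord b))"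
      using binary_chinese_remainder_int by blast
    then have "a [^]\<^bsub>G\<^esub> i = a [^]\<^bsub>G\<^esub> n" "b [^]\<^bsub>H\<^esub> j = b [^]\<^bsub>H\<^esub> n"
      using G.int_pow_eq[OF a] H.int_pow_eq[OF b] by (simp_all add: cong_iff_dvd_diff)
    then have "v = (a, b) [^]\<^bsub>G \<times>\<times> H\<^esub> n"
      using v a b by (simp add: int_pow_DirProd[OF assms(1,2)])
    then show "v \<in> range (\<lambda>n::int. (a, b) [^]\<^bsub>G \<times>\<times> H\<^esub> n)" by blast
  qed
  moreover have ab: "(a, b) \<in> carrier (G \<times>\<times> H)" using a b by simp
  moreover have "range (\<lambda>n::int. (a, b) [^]\<^bsub>G \<times>\<times> H\<^esub> n) \<subseteq> carrier (G \<times>\<times> H)"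
    using GH.int_pow_closed[OF ab] by blast
  ultimately show ?thesis unfolding GH.cyclic_group by blast
qed

lemma DirProd_iso_cong:
  assumes "group G" "group H" "G \<cong> G'" "H \<cong> H'"
  shows "G \<times>\<times> H \<cong> G' \<times>\<times> H'"
proof -
  obtain f g where "f \<in> iso G G'" "g \<in> iso H H'" using assms(3,4) unfolding is_iso_def by blast
  then have "(\<lambda>(x, y). (f x, g y)) \<in> iso (G \<times>\<times> H) (G' \<times>\<times> H')"
    using iso_paired2[OF assms(1,2)] by blast
  then show ?thesis by (rule is_isoI)
qed

lemma order_DirProd: "order (G \<times>\<times> H) = order G * order H"
  by (simp add: order_def card_cartesian_product)

lemma order_iso: "G \<cong> H \<Longrightarrow> order G = order H"
  unfolding order_def by (rule iso_same_card)

section \<open>Assembling a nilpotent group from its \<open>p\<close>-parts\<close>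

context group
begin

text \<open>The normalizer condition for \<open>P\<close> is obtained through nilpotency, which
  passes to subgroups by comparing lower central series.\<close>

lemma nilpotent_p_elements:
  assumes fin: "finite (carrier G)" and nil: "nilpotent G"
    and p: "Factorial_Ring.prime p" and unique: "unique_prime_subgroup G p"
  defines "P \<equiv> G\<lparr>carrier := p_elements p\<rparr>"
  shows "group P" "cyclic_group P \<and> (\<exists>k. order P = p ^ k) \<or> p = 2 \<and> (\<exists>n\<ge>3. P \<cong> generalized_quaternion n)"
proof -
  have sub: "subgroup (p_elements p) G"
    using p_elements_normal[OF fin nilpotent_imp_normalizer_condition[OF nil]] by (rule normal_imp_subgroup)
  interpret P: group P unfolding P_def using sub is_group by (rule subgroup.subgroup_is_group)
  show "group P" by (rule P.is_group)
  have "finite (carrier P)" using fin subgroup.subset[OF sub] by (auto simp: P_def intro: finite_subset)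
  moreover have "normalizer_condition P"
    using nilpotent_subgroup[OF nil sub] P.nilpotent_imp_normalizer_condition by (simp add: P_def)
  moreover have "unique_prime_subgroup P p"
    unfolding P_def using unique_prime_subgroup_subgroup[OF sub unique] .
  moreover have "\<exists>i. x [^]\<^bsub>P\<^esub> (p ^ i) = \<one>\<^bsub>P\<^esub>" if "x \<in> carrier P" for x
    using that by (simp add: P_def p_elements_def flip: nat_pow_consistent)
  ultimately show "cyclic_group P \<and> (\<exists>k. order P = p ^ k) \<or> p = 2 \<and> (\<exists>n\<ge>3. P \<cong> generalized_quaternion n)"
    using P.p_group_unique_prime_subgroup p by blast
qed

text \<open>Each part is cyclic or quaternion. Two cyclic parts of coprime orders combine to a
  cyclic group; the assumption \<open>proper\<close> keeps both parts nontrivial.\<close>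

lemma nilpotent_two_primes:
  assumes fin: "finite (carrier G)" and nil: "nilpotent G"
    and p: "Factorial_Ring.prime p" and q: "Factorial_Ring.prime q" and neq: "p \<noteq> q"
    and few: "few_prime_subgroups G p q"
    and proper: "p_elements p \<noteq> carrier G" "p_elements q \<noteq> carrier G"
  shows "(\<exists>a\<ge>3. \<exists>b\<ge>1. \<exists>q::nat. Factorial_Ring.prime q \<and> odd q \<and>
          G \<cong> generalized_quaternion a \<times>\<times> integer_mod_group (q ^ b))
    \<or> (\<exists>(p::nat) (q::nat) k s. Factorial_Ring.prime p \<and> Factorial_Ring.prime q \<and> p \<noteq> q \<and> k \<ge> 1 \<and> s \<ge> 1 \<and>
          G \<cong> integer_mod_group (p ^ k * q ^ s))" (is ?goal)
proof -
  define S where "S = (\<lambda>r. G\<lparr>carrier := p_elements r\<rparr>)"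
  have nc: "normalizer_condition G" using nil by (rule nilpotent_imp_normalizer_condition)
  have u: "unique_prime_subgroup G p" "unique_prime_subgroup G q" using few by (auto simp: few_prime_subgroups_def)
  have grp: "group (S p)" "group (S q)"
    using nilpotent_p_elements(1)[OF fin nil] p q u by (simp_all add: S_def)
  have iso: "S p \<times>\<times> S q \<cong> G"
    unfolding S_def
    by (rule iso_p_elements_product[OF fin nc]) (use primes_coprime p q neq few in \<open>auto simp: few_prime_subgroups_def\<close>)
  then have isoG: "G \<cong> S p \<times>\<times> S q" using group.iso_sym[OF DirProd_group[OF grp]] by blast
  have order: "order (S p) * order (S q) = order G"
    using order_iso[OF iso] by (simp add: order_DirProd)
  have fin': "finite (carrier (S r))" for r
    using fin by (auto simp: S_def p_elements_def)
  \<comment> \<open>A trivial factor would leave the other one of full order, against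
    \<open>proper\<close>. This is what makes the exponents in the conclusion positive.\<close>
  have ne1: "order (S p) \<noteq> 1" "order (S q) \<noteq> 1"
  proof -
    have "p_elements r \<subseteq> carrier G" for r by (auto simp: p_elements_def)
    then have "order (S r) = order G \<Longrightarrow> p_elements r = carrier G" for r
      using card_subset_eq[OF fin] by (simp add: S_def order_def)
    then have "order (S p) \<noteq> order G" "order (S q) \<noteq> order G" using proper by blast+
    then show "order (S p) \<noteq> 1" "order (S q) \<noteq> 1" using order by auto
  qed
  \<comment> \<open>Stated for arbitrary \<open>p'\<close> and \<open>q'\<close>, so that it serves
    whichever of the two primes is 2.\<close>
  have quaternion: ?goal
    if "S p' \<cong> generalized_quaternion n" "n \<ge> 3" "cyclic_group (S q')" "order (S q') = q' ^ b"
      "group (S p')" "group (S q')" "G \<cong> S p' \<times>\<times> S q'" "Factorial_Ring.prime q'" "q' \<noteq> 2" "order (S q') \<noteq> 1"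
    for p' q' :: nat and n b
  proof -
    have "S q' \<cong> integer_mod_group (q' ^ b)"
      using group.cyclic_iso_integer_mod_group[OF that(6) fin' that(3)] that(4) by simp
    then have "G \<cong> generalized_quaternion n \<times>\<times> integer_mod_group (q' ^ b)"
      using iso_trans[OF that(7) DirProd_iso_cong[OF that(5,6,1)]] by blast
    moreover have "b \<ge> 1" using that(4,10) by (cases b) auto
    moreover have "odd q'" using that(8,9) primes_dvd_imp_eq two_is_prime_nat by blast
    ultimately show ?thesis using that(2,8) by blast
  qed
  have class_p: "cyclic_group (S p) \<and> (\<exists>k. order (S p) = p ^ k) \<or> p = 2 \<and> (\<exists>n\<ge>3. S p \<cong> generalized_quaternion n)"
    unfolding S_def by (rule nilpotent_p_elements(2)[OF fin nil p u(1)])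
  have class_q: "cyclic_group (S q) \<and> (\<exists>k. order (S q) = q ^ k) \<or> q = 2 \<and> (\<exists>n\<ge>3. S q \<cong> generalized_quaternion n)"
    unfolding S_def by (rule nilpotent_p_elements(2)[OF fin nil q u(2)])
  \<comment> \<open>Two quaternion parts would mean \<open>p = q = 2\<close>, so three cases
    remain.\<close>
  consider (cyclic) k s where "cyclic_group (S p)" "order (S p) = p ^ k" "cyclic_group (S q)" "order (S q) = q ^ s"
    | (left) n s where "p = 2" "n \<ge> 3" "S p \<cong> generalized_quaternion n" "cyclic_group (S q)" "order (S q) = q ^ s"
    | (right) n k where "q = 2" "n \<ge> 3" "S q \<cong> generalized_quaternion n" "cyclic_group (S p)" "order (S p) = p ^ k"
    using class_p class_q neq by blast
  then show ?thesis
  proof cases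
    case cyclic
    have "coprime (order (S p)) (order (S q))"
      unfolding cyclic(2,4) using primes_coprime[OF p q neq] by simp
    then have "cyclic_group (S p \<times>\<times> S q)" using cyclic_group_DirProd grp cyclic by blast
    then have "cyclic_group G"
      using isomorphic_group_cyclicity[OF iso DirProd_group[OF grp] is_group] by blast
    then have "G \<cong> integer_mod_group (p ^ k * q ^ s)"
      using cyclic_iso_integer_mod_group[OF fin] order cyclic by simp
    moreover have "k \<ge> 1" "s \<ge> 1" using ne1 cyclic by (cases k; cases s; auto)+
    ultimately show ?thesis using p q neq by blast
  next
    case left
    then show ?thesis using quaternion[of p n q s] grp isoG q neq ne1 by blast
  next
    case right
    have "G \<cong> S q \<times>\<times> S p" using iso_trans[OF isoG DirProd_swap_iso] .
    then show ?thesis using right quaternion[of q n p k] grp p neq ne1 by blast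
  qed
qed

lemma triangle_free_iff_few_prime_subgroups:
  assumes fin: "finite (carrier G)"
  shows "triangle_free (with_proj (intersection_subgroup_graph G)) \<longleftrightarrow>
    (\<exists>p q. Factorial_Ring.prime p \<and> Factorial_Ring.prime q \<and> few_prime_subgroups G p q)"
  unfolding triangle_free_intersection_subgroup_graph_iff[OF fin]
proof
  assume no_tri: "\<nexists>A B C. subgroup A G \<and> subgroup B G \<and> subgroup C G \<and>
     A \<noteq> {\<one>} \<and> B \<noteq> {\<one>} \<and> C \<noteq> {\<one>} \<and> A \<inter> B = {\<one>} \<and> A \<inter> C = {\<one>} \<and> B \<inter> C = {\<one>}"
  show "\<exists>p q. Factorial_Ring.prime p \<and> Factorial_Ring.prime q \<and> few_prime_subgroups G p q"
    by (rule few_prime_subgroups_if_no_triangle[OF fin]) (use no_tri in metis)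
next
  assume "\<exists>p q. Factorial_Ring.prime p \<and> Factorial_Ring.prime q \<and> few_prime_subgroups G p q"
  then show "\<nexists>A B C. subgroup A G \<and> subgroup B G \<and> subgroup C G \<and>
     A \<noteq> {\<one>} \<and> B \<noteq> {\<one>} \<and> C \<noteq> {\<one>} \<and> A \<inter> B = {\<one>} \<and> A \<inter> C = {\<one>} \<and> B \<inter> C = {\<one>}"
    using no_triangle_if_few_prime_subgroups by metis
qed

end

theorem theorem3p1:
  fixes G :: "('a, 'b) monoid_scheme"
  assumes "group G" and "finite (carrier G)" and "nilpotent G"
  shows "triangle_free (with_proj (intersection_subgroup_graph G)) \<longleftrightarrow>
      (\<exists>(p::nat) k. Factorial_Ring.prime p \<and> cyclic_group G \<and> order G = p ^ k)
    \<or> (\<exists>n\<ge>3. G \<cong> generalized_quaternion n)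
    \<or> (\<exists>a\<ge>3. \<exists>b\<ge>1. \<exists>q::nat. Factorial_Ring.prime q \<and> odd q \<and>
          G \<cong> generalized_quaternion a \<times>\<times> integer_mod_group (q ^ b))
    \<or> (\<exists>(p::nat) (q::nat) k s. Factorial_Ring.prime p \<and> Factorial_Ring.prime q \<and> p \<noteq> q \<and> k \<ge> 1 \<and> s \<ge> 1 \<and>
          G \<cong> integer_mod_group (p ^ k * q ^ s))"
    (is "?tf \<longleftrightarrow> ?cyc \<or> ?quat \<or> ?prod \<or> ?two")
proof -
  interpret group G by fact
  note fin = \<open>finite (carrier G)\<close> and nil = \<open>nilpotent G\<close>
  \<comment> \<open>For the converse, uniqueness is checked in the model groups and carried over to
    \<open>G\<close>.\<close>
  have transfer: "few_prime_subgroups G p q"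
    if "group H" "G \<cong> H" "unique_prime_subgroup H p" "unique_prime_subgroup H q" "order H = p ^ i * q ^ j"
    for H :: "('c, 'd) monoid_scheme" and p q i j
    using few_prime_subgroupsI unique_prime_subgroup_iso[OF is_group that(1,2)] that(3-5) order_iso[OF that(2)]
    by simp
  show ?thesis unfolding triangle_free_iff_few_prime_subgroups[OF fin]
  proof
    assume "\<exists>p q. Factorial_Ring.prime p \<and> Factorial_Ring.prime q \<and> few_prime_subgroups G p q"
    then obtain p q where pq: "Factorial_Ring.prime p" "Factorial_Ring.prime q" "few_prime_subgroups G p q" by blast
    then have u: "unique_prime_subgroup G p" "unique_prime_subgroup G q" by (auto simp: few_prime_subgroups_def)
    \<comment> \<open>Here \<open>G\<close> is a group of prime power order; the trivial group is
      included as the cyclic case with \<open>k = 0\<close>.\<close>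
    have single: "?cyc \<or> ?quat" if r: "Factorial_Ring.prime r" "unique_prime_subgroup G r" "p_elements r = carrier G" for r
    proof -
      have "\<And>x. x \<in> carrier G \<Longrightarrow> \<exists>i. x [^]\<^bsub>G\<^esub> (r ^ i) = \<one>\<^bsub>G\<^esub>" using r(3) by (auto simp: p_elements_def)
      then show ?thesis
        using p_group_unique_prime_subgroup[OF fin nilpotent_imp_normalizer_condition[OF nil] r(1,2)] r(1) by blast
    qed
    show "?cyc \<or> ?quat \<or> ?prod \<or> ?two"
    proof (cases "p_elements p = carrier G \<or> p_elements q = carrier G")
      case True
      then show ?thesis using single pq u by blast
    next
      case False
      \<comment> \<open>If \<open>p = q\<close>, every element has \<open>p\<close>-power order and
        the single-prime case would apply.\<close>
      have "p \<noteq> q"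
      proof
        assume "p = q"
        then have "p_elements p = carrier G"
          using pq(3) unfolding few_prime_subgroups_def p_elements_def by (auto simp flip: power_add)
        then show False using False by blast
      qed
      then show ?thesis using nilpotent_two_primes[OF fin nil pq(1,2) _ pq(3)] False by blast
    qed
  next
    assume "?cyc \<or> ?quat \<or> ?prod \<or> ?two"
    then consider
        (cyc) p k where "Factorial_Ring.prime p" "cyclic_group G" "order G = p ^ k"
      | (quat) n where "n \<ge> 3" "G \<cong> generalized_quaternion n"
      | (prod) a b q where "a \<ge> 3" "Factorial_Ring.prime q" "odd q" "G \<cong> generalized_quaternion a \<times>\<times> integer_mod_group (q ^ b)"
      | (two) p q k s where "Factorial_Ring.prime p" "Factorial_Ring.prime q" "G \<cong> integer_mod_group (p ^ k * q ^ s)"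
      by blast
    then show "\<exists>p q. Factorial_Ring.prime p \<and> Factorial_Ring.prime q \<and> few_prime_subgroups G p q"
    proof cases
      case cyc
      then have "unique_prime_subgroup G p" using unique_prime_subgroup_cyclic fin by blast
      \<comment> \<open>The second prime repeats the first, with exponent 0 in the order.\<close>
      then have "few_prime_subgroups G p p" using few_prime_subgroupsI[of p p k 0] cyc by simp
      then show ?thesis using cyc by blast
    next
      case quat
      then have "few_prime_subgroups G 2 2"
        using transfer[OF group_generalized_quaternion quat(2), of 2 2 n 0]
          unique_prime_subgroup_generalized_quaternion[of n] order_generalized_quaternion[of n] by simp
      then show ?thesis using two_is_prime_nat by blast
    next
      case prod
      let ?Q = "generalized_quaternion a" and ?Z = "integer_mod_group (q ^ b)"
      have Q: "group ?Q" "order ?Q = 2 ^ a"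
        using prod group_generalized_quaternion[of a] order_generalized_quaternion[of a] by simp_all
      have Z: "group ?Z" "order ?Z = q ^ b"
        using prod order_integer_mod_group prime_gt_0_nat by simp_all
      have cop: "coprime q ((2::nat) ^ a)" "coprime 2 (q ^ b)" using prod(3) by simp_all
      have "finite (carrier ?Z)" using prod(2) by (simp add: carrier_integer_mod_group prime_gt_0_nat)
      then have "unique_prime_subgroup ?Z q"
        using group.unique_prime_subgroup_cyclic[OF Z(1)] cyclic_integer_mod_group prod(2) by blast
      then have "unique_prime_subgroup (?Q \<times>\<times> ?Z) q"
        using unique_prime_subgroup_DirProd_right[OF Q(1) Z(1)] cop(1) by (simp add: Q)
      moreover have "unique_prime_subgroup (?Q \<times>\<times> ?Z) 2"
        using unique_prime_subgroup_DirProd_left[OF Q(1) Z(1)] unique_prime_subgroup_generalized_quaternion[of a]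
          prod(1) cop(2) by (simp add: Z)
      moreover have "order (?Q \<times>\<times> ?Z) = 2 ^ a * q ^ b" using Q Z by (simp add: order_DirProd)
      ultimately have "few_prime_subgroups G 2 q"
        using transfer[OF DirProd_group[OF Q(1) Z(1)] prod(4)] by blast
      then show ?thesis using two_is_prime_nat prod by blast
    next
      case two
      let ?Z = "integer_mod_group (p ^ k * q ^ s)"
      have pos: "p ^ k * q ^ s > 0" using two by (simp add: prime_gt_0_nat)
      then have "finite (carrier ?Z)" by (simp add: carrier_integer_mod_group)
      then have "unique_prime_subgroup ?Z p" "unique_prime_subgroup ?Z q"
        using group.unique_prime_subgroup_cyclic[OF group_integer_mod_group] cyclic_integer_mod_group two by blast+
      then have "few_prime_subgroups G p q"
        using transfer[OF group_integer_mod_group two(3)] order_integer_mod_group[OF pos] by blast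
      then show ?thesis using two by blast
    qed
  qed
qed

end
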